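(* Let $n\ge 1$ and $m$ be integers with $n-1\le m\le \binom{n}{2}$ and let $A(n,m)=\min\{\delta(G): G\in\mathcal{G}(n,m)\}$. Then: (1) if $m=n-1$, then $A(n,m)=0$; (2) if $m\ge n$ and $2m\le 3n-3$, then $A(n,m)=3/4$; (3) if $m\ge n$ and $2m>3n-3$, then $A(n,m)=1$.
   Context: $\mathcal{G}(n,m)$ is the set of simple connected graphs with $n$ vertices and $m$ edges, in which every edge has length $1$. A graph $G$ is regarded as a metric space whose points are the vertices together with all interior points of edges: each edge is identified isometrically with $[0,1]$ and $d(x,y)$ is the length of a shortest path in $G$ joining $x$ and $y$; this makes $G$ a geodesic metric space. A geodesic triangle $T$ with vertices $x_1,x_2,x_3\in G$ (arbitrary points, not necessarily graph vertices, possibly repeated) is a union of three geodesics $[x_1x_2],[x_2x_3],[x_3x_1]$. It is $\delta$-thin if every point of each side is at distance at most $\delta$ from the union of the two other sides; $\delta(T)$ is the infimum of the $\delta\ge 0$ for which $T$ is $\delta$-thin, and the hyperbolicity constant is $\delta(G)=\sup\{\delta(T): T \text{ a geodesic triangle in } G\}$. *)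

theory Defs
  imports Complex_Main
begin

type_synonym 'a graph = "'a set \<times> 'a set set"

definition simple_graph :: "'a graph \<Rightarrow> bool" where
  "simple_graph G \<longleftrightarrow>
     finite (fst G) \<and> snd G \<subseteq> {{u, v} | u v. u \<in> fst G \<and> v \<in> fst G \<and> u \<noteq> v}"

definition connected_graph :: "'a graph \<Rightarrow> bool" where
  "connected_graph G \<longleftrightarrow>
     fst G \<noteq> {} \<and> (\<forall>u\<in>fst G. \<forall>v\<in>fst G. (u, v) \<in> {(a, b). {a, b} \<in> snd G}\<^sup>*)"

text \<open>Vertices are named by natural numbers; every finite graph is isomorphic to one of these.\<close>

definition graphs :: "nat \<Rightarrow> nat \<Rightarrow> nat graph set" where
  "graphs n m =
     {G. simple_graph G \<and> connected_graph G \<and> card (fst G) = n \<and> card (snd G) = m}"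

text \<open>
  A point of the metric graph is encoded by its barycentric coordinates: \<open>edge_pt u v t\<close> is the
  point of the edge \<open>{u, v}\<close> at distance \<open>t\<close> from \<open>u\<close>. Thus \<open>edge_pt u v t = edge_pt v u (1 - t)\<close>,
  and \<open>edge_pt u v 0\<close> depends only on \<open>u\<close>, which identifies the common endpoints of edges.
  In particular \<open>edge_pt v v 0\<close> is the vertex \<open>v\<close>.
\<close>

definition edge_pt :: "'a \<Rightarrow> 'a \<Rightarrow> real \<Rightarrow> ('a \<Rightarrow> real)" where
  "edge_pt u v t = (\<lambda>w. (1 - t) * of_bool (w = u) + t * of_bool (w = v))"

definition points :: "'a graph \<Rightarrow> ('a \<Rightarrow> real) set" where
  "points G = {edge_pt v v 0 | v. v \<in> fst G} \<union>
              {edge_pt u v t | u v t. {u, v} \<in> snd G \<and> 0 \<le> t \<and> t \<le> 1}"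

text \<open>
  \<open>path_length G x y L\<close>: some piecewise linear path from \<open>x\<close> to \<open>y\<close>, that is, a concatenation of
  finitely many segments each contained in one edge, has length \<open>L\<close>.
\<close>

inductive path_length :: "'a graph \<Rightarrow> ('a \<Rightarrow> real) \<Rightarrow> ('a \<Rightarrow> real) \<Rightarrow> real \<Rightarrow> bool"
  for G :: "'a graph" where
  trivial: "x \<in> points G \<Longrightarrow> path_length G x x 0"
| segment: "{u, v} \<in> snd G \<Longrightarrow> s \<in> {0..1} \<Longrightarrow> t \<in> {0..1} \<Longrightarrow> path_length G (edge_pt u v t) y L
    \<Longrightarrow> path_length G (edge_pt u v s) y (\<bar>s - t\<bar> + L)"

definition graph_dist :: "'a graph \<Rightarrow> ('a \<Rightarrow> real) \<Rightarrow> ('a \<Rightarrow> real) \<Rightarrow> real" where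
  "graph_dist G x y = Inf {L. path_length G x y L}"

text \<open>The next four notions are for an arbitrary metric \<open>d\<close> on a carrier set \<open>M\<close>.\<close>

definition geodesic :: "'p set \<Rightarrow> ('p \<Rightarrow> 'p \<Rightarrow> real) \<Rightarrow> 'p \<Rightarrow> 'p \<Rightarrow> 'p set \<Rightarrow> bool" where
  "geodesic M d x y S \<longleftrightarrow>
     (\<exists>g. g 0 = x \<and> g (d x y) = y \<and> g ` {0..d x y} \<subseteq> M \<and>
          (\<forall>s\<in>{0..d x y}. \<forall>t\<in>{0..d x y}. d (g s) (g t) = \<bar>s - t\<bar>) \<and>
          S = g ` {0..d x y})"

definition thin_triangle ::
    "('p \<Rightarrow> 'p \<Rightarrow> real) \<Rightarrow> 'p set \<Rightarrow> 'p set \<Rightarrow> 'p set \<Rightarrow> real \<Rightarrow> bool" where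
  "thin_triangle d A B C \<delta> \<longleftrightarrow>
     (\<forall>p\<in>A. Inf (d p ` (B \<union> C)) \<le> \<delta>) \<and>
     (\<forall>p\<in>B. Inf (d p ` (C \<union> A)) \<le> \<delta>) \<and>
     (\<forall>p\<in>C. Inf (d p ` (A \<union> B)) \<le> \<delta>)"

definition triangle_delta ::
    "('p \<Rightarrow> 'p \<Rightarrow> real) \<Rightarrow> 'p set \<Rightarrow> 'p set \<Rightarrow> 'p set \<Rightarrow> real" where
  "triangle_delta d A B C = Inf {\<delta>. 0 \<le> \<delta> \<and> thin_triangle d A B C \<delta>}"

text \<open>
  The supremum is taken in the reals, so this is meaningful for bounded spaces only; the metric
  graph of a finite connected graph is bounded.
\<close>

definition hyperbolicity_constant :: "'p set \<Rightarrow> ('p \<Rightarrow> 'p \<Rightarrow> real) \<Rightarrow> real" where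
  "hyperbolicity_constant M d =
     Sup {triangle_delta d A B C | A B C x1 x2 x3.
            x1 \<in> M \<and> x2 \<in> M \<and> x3 \<in> M \<and>
            geodesic M d x1 x2 A \<and> geodesic M d x2 x3 B \<and> geodesic M d x3 x1 C}"

definition graph_delta :: "'a graph \<Rightarrow> real" where
  "graph_delta G = hyperbolicity_constant (points G) (graph_dist G)"

text \<open>
  The minimum exists whenever \<open>graphs n m\<close> is nonempty, since up to isomorphism it is finite.
  \<open>Least\<close> is used because \<open>Min\<close> is only meaningful for sets already known to be finite.
\<close>

definition min_delta :: "nat \<Rightarrow> nat \<Rightarrow> real" where
  "min_delta n m = (LEAST r. r \<in> graph_delta ` graphs n m)"

end

theory Submission
  imports Defs
begin

text \<open>
  Lower bounds. Edgewise \<open>1\<close>-Lipschitz functions bound distances from below. Fix a root and its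
  breadth-first levels. If some vertex has two neighbours (parents) in the level below, the two
  shortest walks through them form a bigon, and one parent is at distance at least \<open>1\<close> from the other
  side; an edge inside a level whose ends have different parents gives a triangle with the same
  property, and every \<open>4\<close>-cycle is a bigon between the midpoints of two opposite edges with the same
  property, witnessed by the midpoint of a third edge. So
  if \<open>\<delta> < 1\<close>, parents are unique, the edges inside levels form a matching that avoids the root, and
  \<open>m \<le> (n - 1) + (n - 1) / 2\<close>. Each of these matching edges closes a triangle with the common parent,
  which forces \<open>\<delta> \<ge> 3 / 4\<close>.

  Upper bounds. A path is isometric to an interval. Otherwise take a cone with apex \<open>c\<close> over a graph
  with \<open>m - n + 1\<close> edges: a matching in the second case, a complete multipartite graph (plus isolated
  vertices) in the third. Two points not separated by \<open>c\<close> are at distance at most \<open>3 / 2\<close>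
  or \<open>2\<close>, and every point is at distance at most \<open>3 / 2\<close> from \<open>c\<close>, so each point of a side is close
  to \<open>c\<close> or to an end of the side.
\<close>

section \<open>Points and distances\<close>

lemma edge_pt_0: "edge_pt u v 0 = edge_pt u u 0"
  by (auto simp: edge_pt_def)

lemma edge_pt_1: "edge_pt u v 1 = edge_pt v v 0"
  by (auto simp: edge_pt_def)

lemma edge_pt_swap: "edge_pt u v t = edge_pt v u (1 - t)"
  by (auto simp: edge_pt_def)

lemma edge_pt_in_points: "{u, v} \<in> snd G \<Longrightarrow> 0 \<le> t \<Longrightarrow> t \<le> 1 \<Longrightarrow> edge_pt u v t \<in> points G"
  unfolding points_def by blast

lemma vertex_in_points: "v \<in> fst G \<Longrightarrow> edge_pt v v 0 \<in> points G"
  unfolding points_def by blast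

locale metric_graph =
  fixes G :: "'a graph"
  assumes simple: "simple_graph G" and conn: "connected_graph G"
begin

abbreviation V where "V \<equiv> fst G"
abbreviation E where "E \<equiv> snd G"
abbreviation d where "d \<equiv> graph_dist G"
abbreviation vtx :: "'a \<Rightarrow> 'a \<Rightarrow> real" where "vtx v \<equiv> edge_pt v v 0"

lemma finite_V: "finite V"
  using simple by (simp add: simple_graph_def)

lemma edgeD: "{u, v} \<in> E \<Longrightarrow> u \<in> V \<and> v \<in> V \<and> u \<noteq> v"
  using simple unfolding simple_graph_def by (auto simp: doubleton_eq_iff dest!: subsetD)

lemma edgeE:
  assumes "e \<in> E"
  obtains u v where "e = {u, v}" "u \<in> V" "v \<in> V" "u \<noteq> v"
  using assms simple unfolding simple_graph_def by blast

lemma finite_E: "finite E"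
proof -
  have "E \<subseteq> Pow V" using simple unfolding simple_graph_def by auto
  then show ?thesis using finite_V finite_subset by blast
qed

lemma pointsE:
  assumes "x \<in> points G"
  obtains (vertex) v where "v \<in> V" "x = vtx v"
  | (edge) u v t where "{u, v} \<in> E" "0 \<le> t" "t \<le> 1" "x = edge_pt u v t"
  using assms unfolding points_def by blast

lemma path_length_nonneg: "path_length G x y L \<Longrightarrow> 0 \<le> L"
  by (induction rule: path_length.induct) auto

lemma path_length_trans:
  "path_length G x y L \<Longrightarrow> path_length G y z M \<Longrightarrow> path_length G x z (L + M)"
proof (induction rule: path_length.induct)
  case (segment u v s t y L)
  then show ?case using path_length.segment[of u v G s t z "L + M"] by (simp add: add.assoc)
qed simp

lemma path_length_segment:
  assumes "{u, v} \<in> E" "s \<in> {0..1}" "t \<in> {0..1}"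
  shows "path_length G (edge_pt u v s) (edge_pt u v t) \<bar>s - t\<bar>"
  using path_length.segment[OF assms path_length.trivial] assms by (auto intro: edge_pt_in_points)

lemma path_length_sym: "path_length G x y L \<Longrightarrow> path_length G y x L"
proof (induction rule: path_length.induct)
  case (segment u v s t y L)
  show ?case
    using path_length_trans[OF segment.IH path_length_segment[OF segment.hyps(1,3,2)]]
    by (simp add: abs_minus_commute add.commute)
qed (simp add: path_length.trivial)

lemma path_exists_vertices:
  assumes "u \<in> V" "v \<in> V"
  shows "\<exists>L. path_length G (vtx u) (vtx v) L"
proof -
  have "(u, v) \<in> {(a, b). {a, b} \<in> E}\<^sup>*"
    using conn assms by (simp add: connected_graph_def)
  then show ?thesis
  proof (induction rule: rtrancl_induct)
    case base
    show ?case using path_length.trivial[OF vertex_in_points[OF assms(1)]] by (rule exI)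
  next
    case (step y z)
    then obtain L where L: "path_length G (vtx u) (vtx y) L" by blast
    have "path_length G (edge_pt y z 0) (edge_pt y z 1) \<bar>0 - 1\<bar>"
      using step by (intro path_length_segment) auto
    then have "path_length G (vtx y) (vtx z) 1" by (simp add: edge_pt_0[of y z] edge_pt_1)
    from path_length_trans[OF L this] show ?case by (rule exI)
  qed
qed

lemma point_near_vertex:
  assumes "x \<in> points G"
  shows "\<exists>v\<in>V. \<exists>L\<le>1. path_length G x (vtx v) L"
  using assms
proof (cases rule: pointsE)
  case (vertex v)
  then show ?thesis using path_length.trivial[OF assms] by (intro bexI[of _ v] exI[of _ 0]) auto
next
  case (edge u v t)
  then have "path_length G x (edge_pt u v 0) t"
    using path_length_segment[of u v t 0] by simp
  then show ?thesis using edge edgeD edge_pt_0[of u v] by (intro bexI[of _ u] exI[of _ t]) auto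
qed

lemma path_exists:
  assumes "x \<in> points G" "y \<in> points G"
  shows "\<exists>L. path_length G x y L"
proof -
  obtain u L where u: "u \<in> V" "path_length G x (vtx u) L"
    using point_near_vertex[OF assms(1)] by blast
  obtain v M where v: "v \<in> V" "path_length G y (vtx v) M"
    using point_near_vertex[OF assms(2)] by blast
  obtain N where "path_length G (vtx u) (vtx v) N"
    using path_exists_vertices u v by blast
  then show ?thesis
    using path_length_trans[OF u(2)] path_length_trans path_length_sym[OF v(2)] by blast
qed

lemma dist_le: "path_length G x y L \<Longrightarrow> d x y \<le> L"
  unfolding graph_dist_def by (rule cInf_lower) (auto intro!: bdd_belowI[of _ 0] path_length_nonneg)

lemma dist_ge:
  assumes "x \<in> points G" "y \<in> points G" "\<And>L. path_length G x y L \<Longrightarrow> r \<le> L"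
  shows "r \<le> d x y"
  unfolding graph_dist_def using assms path_exists by (intro cInf_greatest) auto

lemma dist_nonneg: "x \<in> points G \<Longrightarrow> y \<in> points G \<Longrightarrow> 0 \<le> d x y"
  using dist_ge path_length_nonneg by blast

lemma dist_self: "x \<in> points G \<Longrightarrow> d x x = 0"
  using dist_le[OF path_length.trivial] dist_nonneg by fastforce

lemma dist_sym: "d x y = d y x"
proof -
  have "path_length G x y = path_length G y x" using path_length_sym by blast
  then show ?thesis unfolding graph_dist_def by simp
qed

lemma dist_triangle:
  assumes "x \<in> points G" "y \<in> points G" "z \<in> points G"
  shows "d x z \<le> d x y + d y z"
proof -
  \<comment> \<open>The two infima are handled in turn: a path from \<open>x\<close> to
    \<open>y\<close> is fixed first, then one from \<open>y\<close> to \<open>z\<close>.\<close>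
  have "d x z - d y z \<le> d x y"
  proof (rule dist_ge)
    fix L assume L: "path_length G x y L"
    have "d x z - L \<le> d y z"
    proof (rule dist_ge)
      fix M assume "path_length G y z M"
      then show "d x z - L \<le> M" using dist_le[OF path_length_trans[OF L]] by fastforce
    qed (use assms in auto)
    then show "d x z - d y z \<le> L" by simp
  qed (use assms in auto)
  then show ?thesis by simp
qed

lemma dist_segment:
  "{u, v} \<in> E \<Longrightarrow> s \<in> {0..1} \<Longrightarrow> t \<in> {0..1} \<Longrightarrow> d (edge_pt u v s) (edge_pt u v t) \<le> \<bar>s - t\<bar>"
  by (intro dist_le path_length_segment)

text \<open>Needed to bound all triangles at once; without it the real \<open>Sup\<close> in the
  hyperbolicity constant would carry no information. Every point is within \<open>1\<close> of a
  vertex, hence the summand \<open>2\<close>.\<close>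

lemma dist_bounded: "\<exists>K\<ge>0. \<forall>x\<in>points G. \<forall>y\<in>points G. d x y \<le> K"
proof -
  define S where "S = (\<lambda>(u, v). d (vtx u) (vtx v)) ` (V \<times> V)"
  have S: "finite S" unfolding S_def using finite_V by simp
  have "d x y \<le> \<bar>Max S\<bar> + 2" if xy: "x \<in> points G" "y \<in> points G" for x y
  proof -
    obtain u where u: "u \<in> V" "d x (vtx u) \<le> 1"
      using point_near_vertex[OF xy(1)] dist_le order_trans by meson
    obtain v where v: "v \<in> V" "d y (vtx v) \<le> 1"
      using point_near_vertex[OF xy(2)] dist_le order_trans by meson
    have "d (vtx u) (vtx v) \<in> S" unfolding S_def using u v by force
    then have "d (vtx u) (vtx v) \<le> Max S" using S by simp
    moreover have "d x y \<le> d x (vtx u) + d (vtx u) y"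
      "d (vtx u) y \<le> d (vtx u) (vtx v) + d (vtx v) y"
      using xy vertex_in_points[OF u(1)] vertex_in_points[OF v(1)] by (auto intro!: dist_triangle)
    ultimately show ?thesis using u v dist_sym[of "vtx v" y] by linarith
  qed
  then show ?thesis by (intro exI[of _ "\<bar>Max S\<bar> + 2"]) auto
qed

section \<open>Lower bounds on distances from Lipschitz functions\<close>

definition edge_lipschitz :: "(('a \<Rightarrow> real) \<Rightarrow> real) \<Rightarrow> bool" where
  "edge_lipschitz F \<longleftrightarrow> (\<forall>u v s t. {u, v} \<in> E \<longrightarrow> s \<in> {0..1} \<longrightarrow> t \<in> {0..1} \<longrightarrow>
     \<bar>F (edge_pt u v s) - F (edge_pt u v t)\<bar> \<le> \<bar>s - t\<bar>)"

text \<open>On each segment of a path \<open>F\<close> changes by at most the length of the segment,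
  so its total change is at most the length of the path.\<close>

lemma dist_ge_lipschitz:
  assumes F: "edge_lipschitz F" and "x \<in> points G" "y \<in> points G"
  shows "\<bar>F x - F y\<bar> \<le> d x y"
proof (rule dist_ge)
  show "\<bar>F x - F y\<bar> \<le> L" if "path_length G x y L" for L
    using that
  proof (induction rule: path_length.induct)
    case (segment u v s t y L)
    then have "\<bar>F (edge_pt u v s) - F (edge_pt u v t)\<bar> \<le> \<bar>s - t\<bar>"
      using F unfolding edge_lipschitz_def by blast
    with segment show ?case by linarith
  qed simp
qed (use assms in auto)

text \<open>The affine extension of a vertex function to the edges, read off from the barycentric
  coordinates.\<close>

definition lin_ext :: "('a \<Rightarrow> real) \<Rightarrow> ('a \<Rightarrow> real) \<Rightarrow> real" where
  "lin_ext f z = (\<Sum>w\<in>V. z w * f w)"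

lemma lin_ext_edge_pt:
  assumes "u \<in> V" "v \<in> V"
  shows "lin_ext f (edge_pt u v t) = (1 - t) * f u + t * f v"
proof -
  have "lin_ext f (edge_pt u v t) =
      (\<Sum>w\<in>V. (if w = u then (1 - t) * f w else 0) + (if w = v then t * f w else 0))"
    unfolding lin_ext_def edge_pt_def by (intro sum.cong) (auto simp: algebra_simps)
  then show ?thesis using assms finite_V by (simp add: sum.distrib)
qed

lemma lin_ext_lipschitz:
  assumes "\<And>u v. {u, v} \<in> E \<Longrightarrow> \<bar>f u - f v\<bar> \<le> 1"
  shows "edge_lipschitz (lin_ext f)"
  unfolding edge_lipschitz_def
proof (intro allI impI)
  fix u v and s t :: real assume e: "{u, v} \<in> E"
  have "lin_ext f (edge_pt u v s) - lin_ext f (edge_pt u v t) = (s - t) * (f v - f u)"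
    using edgeD[OF e] by (simp add: lin_ext_edge_pt algebra_simps)
  moreover have "\<bar>f v - f u\<bar> \<le> 1" using assms[OF e] by simp
  ultimately show "\<bar>lin_ext f (edge_pt u v s) - lin_ext f (edge_pt u v t)\<bar> \<le> \<bar>s - t\<bar>"
    by (simp add: abs_mult mult_left_le)
qed

lemma coordinate_lipschitz: "edge_lipschitz (\<lambda>z. z w)"
  unfolding edge_lipschitz_def
proof (intro allI impI)
  fix u v and s t :: real assume "{u, v} \<in> E"
  then have "u \<noteq> v" using edgeD by blast
  then show "\<bar>edge_pt u v s w - edge_pt u v t w\<bar> \<le> \<bar>s - t\<bar>"
    by (auto simp: edge_pt_def)
qed

text \<open>The coordinate \<open>z v\<close> is \<open>1\<close>-Lipschitz and equals
  \<open>1\<close> at \<open>v\<close>.\<close>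

lemma dist_vertex_ge_1:
  assumes "v \<in> V" "z \<in> points G" "z v = 0"
  shows "1 \<le> d (vtx v) z"
  using dist_ge_lipschitz[OF coordinate_lipschitz[of v] vertex_in_points[OF assms(1)] assms(2)] assms(3)
  by (simp add: edge_pt_def)

end

section \<open>Geodesics and thin triangles\<close>

text \<open>Unit-speed parametrization of the vertex sequence \<open>v\<close>. At an integer time
  the following vertex has weight \<open>0\<close>, so the arbitrary value of \<open>v\<close> after
  the end of a walk does no harm.\<close>

definition walk_pt :: "(nat \<Rightarrow> 'a) \<Rightarrow> real \<Rightarrow> 'a \<Rightarrow> real" where
  "walk_pt v t = edge_pt (v (nat \<lfloor>t\<rfloor>)) (v (Suc (nat \<lfloor>t\<rfloor>))) (frac t)"

text \<open>The right end \<open>real i + 1\<close> is included although the floor there already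
  selects the next edge; a point at an integer time can thus be read on either adjacent
  edge.\<close>

lemma walk_pt_eq:
  assumes "real i \<le> t" "t \<le> real i + 1"
  shows "walk_pt v t = edge_pt (v i) (v (Suc i)) (t - real i)"
proof (cases "t = real i + 1")
  case True
  then have "\<lfloor>t\<rfloor> = int (Suc i)" by simp
  then have "walk_pt v t = edge_pt (v (Suc i)) (v (Suc (Suc i))) 0"
    using True by (simp add: walk_pt_def frac_def nat_add_distrib)
  then show ?thesis
    using True by (simp add: edge_pt_1 edge_pt_0[of "v (Suc i)" "v (Suc (Suc i))"])
next
  case False
  then have "\<lfloor>t\<rfloor> = int i" using assms by (intro floor_unique) auto
  then show ?thesis by (simp add: walk_pt_def frac_def)
qed

lemma walk_pt_nat: "walk_pt v (real i) = edge_pt (v i) (v i) 0"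
  using walk_pt_eq[of i "real i" v] by (simp add: edge_pt_0[of "v i" "v (Suc i)"])

lemma geodesic_sym:
  assumes "geodesic M d x y S" "d x y = d y x"
  shows "geodesic M d y x S"
proof -
  define D where "D = d x y"
  obtain g where g: "g 0 = x" "g D = y" "g ` {0..D} \<subseteq> M"
    "\<forall>s\<in>{0..D}. \<forall>t\<in>{0..D}. d (g s) (g t) = \<bar>s - t\<bar>" "S = g ` {0..D}"
    using assms(1) unfolding geodesic_def D_def by blast
  have im: "(\<lambda>t. g (D - t)) ` {0..D} = g ` {0..D}"
    using image_image[of g "(-) D" "{0..D}"] by simp
  show ?thesis
    unfolding geodesic_def assms(2)[symmetric] D_def[symmetric]
    using g im by (intro exI[of _ "\<lambda>t. g (D - t)"]) auto
qed

context metric_graph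
begin

section \<open>Walks as geodesics\<close>

definition walk :: "(nat \<Rightarrow> 'a) \<Rightarrow> nat \<Rightarrow> bool" where
  "walk v k \<longleftrightarrow> v 0 \<in> V \<and> (\<forall>i<k. {v i, v (Suc i)} \<in> E)"

lemma walk_pt_in_points: "walk v k \<Longrightarrow> 0 \<le> t \<Longrightarrow> t \<le> real k \<Longrightarrow> walk_pt v t \<in> points G"
proof (induction k)
  case 0
  then show ?case using walk_pt_nat[of v 0] vertex_in_points[of "v 0"] by (simp add: walk_def)
next
  case (Suc k)
  show ?case
  proof (cases "t \<le> real k")
    case True
    then show ?thesis using Suc by (simp add: walk_def)
  next
    case False
    then show ?thesis using Suc.prems walk_pt_eq[of k t v]
      by (auto simp: walk_def intro: edge_pt_in_points)
  qed
qed

lemma walk_pt_dist_le: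
  "walk v k \<Longrightarrow> 0 \<le> s \<Longrightarrow> s \<le> t \<Longrightarrow> t \<le> real k \<Longrightarrow> d (walk_pt v s) (walk_pt v t) \<le> t - s"
proof (induction k arbitrary: s t)
  case 0
  then have st: "s = 0" "t = 0" by auto
  show ?case unfolding st using dist_self walk_pt_in_points[OF 0(1), of 0] by simp
next
  case (Suc k)
  have wk: "walk v k" and e: "{v k, v (Suc k)} \<in> E" using Suc.prems(1) by (auto simp: walk_def)
  have seg: "d (walk_pt v a) (walk_pt v b) \<le> b - a" if "real k \<le> a" "a \<le> b" "b \<le> real (Suc k)" for a b
    using that dist_segment[OF e, of "a - real k" "b - real k"]
      walk_pt_eq[of k a v] walk_pt_eq[of k b v] by auto
  consider "t \<le> real k" | "real k \<le> s" | "s < real k" "real k < t" by linarith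
  then show ?case
  proof cases
    case 3
    have "d (walk_pt v s) (walk_pt v t) \<le>
        d (walk_pt v s) (walk_pt v (real k)) + d (walk_pt v (real k)) (walk_pt v t)"
      using Suc.prems 3 by (intro dist_triangle) (auto intro!: walk_pt_in_points[of v "Suc k"])
    moreover have "d (walk_pt v s) (walk_pt v (real k)) \<le> real k - s"
      using Suc.IH[OF wk] Suc.prems 3 by auto
    moreover have "d (walk_pt v (real k)) (walk_pt v t) \<le> t - real k"
      using seg Suc.prems 3 by auto
    ultimately show ?thesis by simp
  qed (use Suc wk seg in auto)
qed

text \<open>The three pieces cut out by \<open>s\<close> and \<open>t\<close> are no longer than
  their parameter lengths, while together they must cover \<open>b - a\<close>; hence each of these
  bounds is an equality.\<close>

lemma geodesic_walk:
  assumes w: "walk v k" and s: "0 \<le> a" "a \<le> b" "b \<le> real k"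
    and D: "b - a \<le> d (walk_pt v a) (walk_pt v b)"
  shows "geodesic (points G) d (walk_pt v a) (walk_pt v b) (walk_pt v ` {a..b})"
proof -
  have D: "d (walk_pt v a) (walk_pt v b) = b - a"
    using D walk_pt_dist_le[OF w s] by simp
  have pts: "walk_pt v t \<in> points G" if "t \<in> {a..b}" for t
    using that s by (intro walk_pt_in_points[OF w]) auto
  have mono: "d (walk_pt v s) (walk_pt v t) = t - s" if st: "a \<le> s" "s \<le> t" "t \<le> b" for s t
  proof -
    have "d (walk_pt v a) (walk_pt v b) \<le> d (walk_pt v a) (walk_pt v s) + d (walk_pt v s) (walk_pt v b)"
      "d (walk_pt v s) (walk_pt v b) \<le> d (walk_pt v s) (walk_pt v t) + d (walk_pt v t) (walk_pt v b)"
      using st by (auto intro!: dist_triangle pts)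
    moreover have "d (walk_pt v a) (walk_pt v s) \<le> s - a" "d (walk_pt v s) (walk_pt v t) \<le> t - s"
      "d (walk_pt v t) (walk_pt v b) \<le> b - t"
      using st s by (auto intro!: walk_pt_dist_le[OF w])
    ultimately show ?thesis using D by linarith
  qed
  have "d (walk_pt v (a + s)) (walk_pt v (a + t)) = \<bar>s - t\<bar>" if "s \<in> {0..b - a}" "t \<in> {0..b - a}" for s t
    using that mono[of "a + s" "a + t"] mono[of "a + t" "a + s"] dist_sym
    by (cases "s \<le> t") auto
  moreover have "(\<lambda>t. walk_pt v (a + t)) ` {0..b - a} = walk_pt v ` {a..b}"
    using image_image[of "walk_pt v" "(+) a" "{0..b - a}"] by simp
  ultimately show ?thesis
    unfolding geodesic_def D using pts by (intro exI[of _ "\<lambda>t. walk_pt v (a + t)"]) auto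
qed

lemma geodesic_trivial: "x \<in> points G \<Longrightarrow> geodesic (points G) d x x {x}"
  unfolding geodesic_def by (intro exI[of _ "\<lambda>_. x"]) (auto simp: dist_self)

section \<open>Sides of triangles\<close>

abbreviation geo :: "('a \<Rightarrow> real) \<Rightarrow> ('a \<Rightarrow> real) \<Rightarrow> ('a \<Rightarrow> real) set \<Rightarrow> bool" where
  "geo \<equiv> geodesic (points G) d"

lemma geo_ends:
  assumes "geo x y S" "x \<in> points G" "y \<in> points G"
  shows "x \<in> S \<and> y \<in> S"
proof -
  obtain g where "g 0 = x" "g (d x y) = y" "S = g ` {0..d x y}"
    using assms(1) unfolding geodesic_def by blast
  then show ?thesis using dist_nonneg[OF assms(2,3)] by force
qed

lemma geo_subset: "geo x y S \<Longrightarrow> S \<subseteq> points G"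
  unfolding geodesic_def by blast

text \<open>The side is an isometric interval; the two cases are the two orders of \<open>p\<close>
  and \<open>q\<close> on it.\<close>

lemma geo_between:
  assumes "geo x y S" "x \<in> points G" "y \<in> points G" "p \<in> S" "q \<in> S"
  shows "d x p + d p q = d x q \<or> d q p + d p y = d q y"
proof -
  define D where "D = d x y"
  obtain g where g: "g 0 = x" "g D = y"
    "\<forall>s\<in>{0..D}. \<forall>t\<in>{0..D}. d (g s) (g t) = \<bar>s - t\<bar>" "S = g ` {0..D}"
    using assms(1) unfolding geodesic_def D_def by blast
  obtain s t where st: "s \<in> {0..D}" "t \<in> {0..D}" "p = g s" "q = g t" using assms(4,5) g(4) by auto
  have "0 \<in> {0..D}" "D \<in> {0..D}" using dist_nonneg[OF assms(2,3)] D_def by auto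
  then have "d x p = s" "d p q = \<bar>s - t\<bar>" "d x q = t" "d q p = \<bar>t - s\<bar>" "d p y = D - s" "d q y = D - t"
    using g(3) st unfolding g(1)[symmetric] g(2)[symmetric] by fastforce+
  then show ?thesis by auto
qed

lemma geo_dist_add:
  assumes "geo x y S" "x \<in> points G" "y \<in> points G" "p \<in> S"
  shows "d x p + d p y = d x y"
proof -
  define D where "D = d x y"
  obtain g where g: "g 0 = x" "g D = y"
    "\<forall>s\<in>{0..D}. \<forall>t\<in>{0..D}. d (g s) (g t) = \<bar>s - t\<bar>" "S = g ` {0..D}"
    using assms(1) unfolding geodesic_def D_def by blast
  obtain s where s: "s \<in> {0..D}" "p = g s" using assms(4) g(4) by auto
  then have "0 \<in> {0..D}" "D \<in> {0..D}" by auto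
  then have "d (g 0) (g s) = \<bar>0 - s\<bar>" "d (g s) (g D) = \<bar>s - D\<bar>" using g(3) s(1) by blast+
  then show ?thesis using s g(1,2) by (simp add: D_def)
qed

text \<open>Along the side \<open>F\<close> is a \<open>1\<close>-Lipschitz function of the
  parameter, hence continuous.\<close>

lemma geo_ivt:
  assumes "geo x y S" "x \<in> points G" "y \<in> points G" and F: "edge_lipschitz F"
    and c: "F x \<le> c" "c \<le> F y"
  shows "\<exists>z\<in>S. F z = c"
proof -
  define D where "D = d x y"
  obtain g where g: "g 0 = x" "g D = y" "g ` {0..D} \<subseteq> points G"
    "\<forall>s\<in>{0..D}. \<forall>t\<in>{0..D}. d (g s) (g t) = \<bar>s - t\<bar>" "S = g ` {0..D}"
    using assms(1) unfolding geodesic_def D_def by blast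
  have D: "0 \<le> D" using dist_nonneg[OF assms(2,3)] D_def by simp
  have lip: "\<bar>F (g s) - F (g t)\<bar> \<le> \<bar>s - t\<bar>" if "s \<in> {0..D}" "t \<in> {0..D}" for s t
  proof -
    have "g s \<in> points G" "g t \<in> points G" "d (g s) (g t) = \<bar>s - t\<bar>" using g(3,4) that by blast+
    then show ?thesis using dist_ge_lipschitz[OF F, of "g s" "g t"] by simp
  qed
  have "continuous_on {0..D} (\<lambda>t. F (g t))"
    unfolding continuous_on_def
  proof
    fix t assume t: "t \<in> {0..D}"
    show "((\<lambda>s. F (g s)) \<longlongrightarrow> F (g t)) (at t within {0..D})"
    proof (rule metric_tendsto_imp_tendsto)
      show "\<forall>\<^sub>F s in at t within {0..D}. dist (F (g s)) (F (g t)) \<le> dist s t"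
        using lip t by (auto simp: eventually_at_filter dist_real_def)
    qed (rule tendsto_ident_at)
  qed
  then obtain t where "0 \<le> t" "t \<le> D" "F (g t) = c"
    using IVT'[of "\<lambda>t. F (g t)" 0 c D] c g(1,2) D by auto
  then show ?thesis using g(5) by auto
qed

text \<open>The level \<open>c\<close> is crossed on \<open>[yz]\<close> or on \<open>[zx]\<close>,
  depending on whether \<open>F z\<close> lies below or above it.\<close>

lemma geo_two_sides_ivt:
  assumes "geo y z B" "geo z x C" "x \<in> points G" "y \<in> points G" "z \<in> points G"
    and F: "edge_lipschitz F" and c: "F x \<le> c" "c \<le> F y"
  shows "\<exists>w\<in>B \<union> C. F w = c"
proof (cases "F z \<le> c")
  case True
  then show ?thesis
    using geo_ivt[OF geodesic_sym[OF assms(1)] assms(5,4) F True c(2)] dist_sym by auto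
next
  case False
  then show ?thesis
    using geo_ivt[OF geodesic_sym[OF assms(2)] assms(3,5) F c(1)] dist_sym by fastforce
qed

section \<open>Bounds for the hyperbolicity constant\<close>

lemma Inf_dist_le:
  assumes "p \<in> points G" "S \<subseteq> points G" "q \<in> S" "d p q \<le> r"
  shows "Inf (d p ` S) \<le> r"
proof -
  have "Inf (d p ` S) \<le> d p q"
    using assms by (intro cInf_lower) (auto intro!: bdd_belowI[of _ 0] dist_nonneg)
  then show ?thesis using assms by simp
qed

lemma triangle_delta_le:
  assumes "0 \<le> r" and "A \<subseteq> points G" "B \<subseteq> points G" "C \<subseteq> points G"
    and "\<And>p. p \<in> A \<Longrightarrow> \<exists>q\<in>B \<union> C. d p q \<le> r"
    and "\<And>p. p \<in> B \<Longrightarrow> \<exists>q\<in>C \<union> A. d p q \<le> r"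
    and "\<And>p. p \<in> C \<Longrightarrow> \<exists>q\<in>A \<union> B. d p q \<le> r"
  shows "thin_triangle d A B C r" "triangle_delta d A B C \<le> r"
proof -
  show thin: "thin_triangle d A B C r"
    unfolding thin_triangle_def
    using assms Inf_dist_le[of _ "B \<union> C"] Inf_dist_le[of _ "C \<union> A"] Inf_dist_le[of _ "A \<union> B"]
    by (meson Un_least subsetD)
  show "triangle_delta d A B C \<le> r"
    unfolding triangle_delta_def using thin assms(1)
    by (intro cInf_lower) (auto intro!: bdd_belowI[of _ 0])
qed

text \<open>One bound for all triangles serves twice: the set under the infimum in
  \<open>triangle_delta\<close> is nonempty, and the set under the supremum in
  \<open>graph_delta\<close> is bounded above.\<close>

lemma triangle_bounded:
  "\<exists>K\<ge>0. \<forall>x\<in>points G. \<forall>y\<in>points G. \<forall>z\<in>points G. \<forall>A B C. geo x y A \<longrightarrow> geo y z B \<longrightarrow> geo z x C \<longrightarrow>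
     thin_triangle d A B C K \<and> triangle_delta d A B C \<le> K"
proof -
  obtain K where K: "K \<ge> 0" "\<And>x y. x \<in> points G \<Longrightarrow> y \<in> points G \<Longrightarrow> d x y \<le> K"
    using dist_bounded by blast
  have "thin_triangle d A B C K \<and> triangle_delta d A B C \<le> K"
    if xyz: "x \<in> points G" "y \<in> points G" "z \<in> points G" and geo: "geo x y A" "geo y z B" "geo z x C"
    for x y z A B C
  proof -
    note sub = geo_subset[OF geo(1)] geo_subset[OF geo(2)] geo_subset[OF geo(3)]
    have x: "x \<in> A" "x \<in> C" "y \<in> B"
      using geo_ends[OF geo(1)] geo_ends[OF geo(2)] geo_ends[OF geo(3)] xyz by auto
    have "\<exists>q\<in>B \<union> C. d p q \<le> K" if "p \<in> A" for p
      using that sub x xyz by (intro bexI[of _ x]) (auto intro: K)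
    moreover have "\<exists>q\<in>C \<union> A. d p q \<le> K" if "p \<in> B" for p
      using that sub x xyz by (intro bexI[of _ x]) (auto intro: K)
    moreover have "\<exists>q\<in>A \<union> B. d p q \<le> K" if "p \<in> C" for p
      using that sub x xyz by (intro bexI[of _ x]) (auto intro: K)
    ultimately show ?thesis using triangle_delta_le[OF K(1) sub] by blast
  qed
  with K(1) show ?thesis by (intro exI[of _ K]) blast
qed

lemma graph_delta_ge:
  assumes xyz: "x \<in> points G" "y \<in> points G" "z \<in> points G"
    and geo: "geo x y A" "geo y z B" "geo z x C"
    and p: "p \<in> A" "\<And>q. q \<in> B \<union> C \<Longrightarrow> r \<le> d p q"
  shows "r \<le> graph_delta G"
proof -
  obtain K where K: "K \<ge> 0" "\<forall>x\<in>points G. \<forall>y\<in>points G. \<forall>z\<in>points G. \<forall>A B C.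
      geo x y A \<longrightarrow> geo y z B \<longrightarrow> geo z x C \<longrightarrow> thin_triangle d A B C K \<and> triangle_delta d A B C \<le> K"
    using triangle_bounded by auto
  have ne: "B \<union> C \<noteq> {}" using geo_ends[OF geo(2)] xyz by auto
  have "r \<le> triangle_delta d A B C"
    unfolding triangle_delta_def
  proof (rule cInf_greatest)
    show "{\<delta>. 0 \<le> \<delta> \<and> thin_triangle d A B C \<delta>} \<noteq> {}" using K xyz geo by blast
    fix \<delta> assume "\<delta> \<in> {\<delta>. 0 \<le> \<delta> \<and> thin_triangle d A B C \<delta>}"
    then have "Inf (d p ` (B \<union> C)) \<le> \<delta>" using p(1) unfolding thin_triangle_def by blast
    moreover have "r \<le> Inf (d p ` (B \<union> C))" using ne p(2) by (intro cInf_greatest) auto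
    ultimately show "r \<le> \<delta>" by simp
  qed
  also have "\<dots> \<le> graph_delta G"
    unfolding graph_delta_def hyperbolicity_constant_def
  proof (rule cSup_upper)
    show "bdd_above {triangle_delta d A B C |A B C x1 x2 x3. x1 \<in> points G \<and> x2 \<in> points G \<and>
        x3 \<in> points G \<and> geo x1 x2 A \<and> geo x2 x3 B \<and> geo x3 x1 C}"
      using K(2) by (intro bdd_aboveI[of _ K]) blast
  qed (use xyz geo in blast)
  finally show ?thesis .
qed

lemma points_nonempty: "points G \<noteq> {}"
  using conn vertex_in_points[of _ G] unfolding connected_graph_def by blast

lemma graph_delta_nonneg: "0 \<le> graph_delta G"
proof -
  obtain x where x: "x \<in> points G" using points_nonempty by blast
  note g = geodesic_trivial[OF x]
  show ?thesis by (rule graph_delta_ge[OF x x x g g g]) (auto simp: dist_self x)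
qed

lemma graph_delta_le:
  assumes r: "0 \<le> r"
    and *: "\<And>x y z A B C p. x \<in> points G \<Longrightarrow> y \<in> points G \<Longrightarrow> z \<in> points G \<Longrightarrow>
      geo x y A \<Longrightarrow> geo y z B \<Longrightarrow> geo z x C \<Longrightarrow> p \<in> A \<Longrightarrow> \<exists>q\<in>B \<union> C. d p q \<le> r"
  shows "graph_delta G \<le> r"
  unfolding graph_delta_def hyperbolicity_constant_def
proof (rule cSup_least)
  obtain x where x: "x \<in> points G" using points_nonempty by blast
  show "{triangle_delta d A B C |A B C x1 x2 x3. x1 \<in> points G \<and> x2 \<in> points G \<and>
        x3 \<in> points G \<and> geo x1 x2 A \<and> geo x2 x3 B \<and> geo x3 x1 C} \<noteq> {}"
    using x geodesic_trivial[OF x] by blast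
  fix \<delta> assume "\<delta> \<in> {triangle_delta d A B C |A B C x1 x2 x3. x1 \<in> points G \<and> x2 \<in> points G \<and>
        x3 \<in> points G \<and> geo x1 x2 A \<and> geo x2 x3 B \<and> geo x3 x1 C}"
  then obtain x y z A B C where t: "\<delta> = triangle_delta d A B C" "x \<in> points G" "y \<in> points G" "z \<in> points G"
    "geo x y A" "geo y z B" "geo z x C" by blast
  show "\<delta> \<le> r" unfolding t(1)
    \<comment> \<open>The hypothesis treats the side \<open>A\<close> only; the other two sides are
      obtained by rotating the triangle.\<close>
    using *[OF t(2-7)] *[OF t(3,4,2,6,7,5)] *[OF t(4,2,3,7,5,6)]
    by (intro triangle_delta_le(2)[OF r geo_subset[OF t(5)] geo_subset[OF t(6)] geo_subset[OF t(7)]])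
qed

end

section \<open>Short cycles\<close>

context metric_graph
begin

text \<open>If \<open>{a, b}\<close> is an edge, this function is the distance from its midpoint,
  cut off at \<open>3 / 2\<close>.\<close>

lemma lipschitz_to_midpoint:
  assumes "a \<noteq> b"
  shows "edge_lipschitz (\<lambda>z. 3 / 2 - z a - z b - min (z a) (z b))"
  unfolding edge_lipschitz_def
proof (intro allI impI)
  fix u v and s t :: real
  let ?F = "\<lambda>z. 3 / 2 - z a - z b - min (z a) (z b)"
  assume e: "{u, v} \<in> E" and st: "s \<in> {0..1}" "t \<in> {0..1}"
  have "u \<noteq> v" using edgeD[OF e] by simp
  then show "\<bar>?F (edge_pt u v s) - ?F (edge_pt u v t)\<bar> \<le> \<bar>s - t\<bar>"
    using assms st
    by (cases "u = a"; cases "u = b"; cases "v = a"; cases "v = b") (simp_all add: edge_pt_def)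
qed

text \<open>If \<open>{a, b}\<close> is an edge, this function is the distance from its point at
  distance \<open>1 / 4\<close> from \<open>b\<close>, cut off at \<open>3 / 4\<close>, the distance
  of that point from \<open>a\<close>.\<close>

lemma lipschitz_to_quarter_point:
  assumes "a \<noteq> b"
  shows "edge_lipschitz (\<lambda>z. min (3 / 4) (\<bar>z a - 1 / 4\<bar> + 1 - z a - z b))"
  unfolding edge_lipschitz_def
proof (intro allI impI)
  fix u v and s t :: real
  define F :: "('a \<Rightarrow> real) \<Rightarrow> real" where "F = (\<lambda>z. min (3 / 4) (\<bar>z a - 1 / 4\<bar> + 1 - z a - z b))"
  assume e: "{u, v} \<in> E" and st: "s \<in> {0..1}" "t \<in> {0..1}"
  have uv: "u \<noteq> v" using edgeD[OF e] by simp
  have F: "F (edge_pt u v s) = (if u = a then if v = b then \<bar>3 / 4 - s\<bar> else 3 / 4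
      else if v = a then if u = b then \<bar>s - 1 / 4\<bar> else 3 / 4
      else if u = b then min (3 / 4) (1 / 4 + s) else if v = b then min (3 / 4) (5 / 4 - s) else 3 / 4)"
    if "s \<in> {0..1}" for s
    using that assms uv by (auto simp: F_def edge_pt_def min_def abs_if)
  show "\<bar>F (edge_pt u v s) - F (edge_pt u v t)\<bar> \<le> \<bar>s - t\<bar>"
    unfolding F[OF st(1)] F[OF st(2)] using st by (auto simp: min_def)
qed

text \<open>On the edge \<open>{a, b}\<close> the minimum gives slope \<open>1\<close>, where the linear part is constant; on the
  other edges at \<open>a\<close> or \<open>b\<close> the slope is only \<open>1 / 2\<close>, so that two such functions for disjoint
  edges can be combined.\<close>

definition half_sum_min :: "'a \<Rightarrow> 'a \<Rightarrow> ('a \<Rightarrow> real) \<Rightarrow> real" where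
  "half_sum_min a b z = (z a + z b) / 2 + min (z a) (z b)"

lemma half_sum_min_edge_pt:
  assumes "u \<noteq> v" "a \<noteq> b" "s \<in> {0..1}"
  shows "half_sum_min a b (edge_pt u v s) = (if {u, v} = {a, b} then 1 / 2 + min s (1 - s) else
     if u \<in> {a, b} then (1 - s) / 2 else if v \<in> {a, b} then s / 2 else 0)"
  using assms by (auto simp: half_sum_min_def edge_pt_def doubleton_eq_iff min_def)

lemma half_sum_min_diff:
  assumes "u \<noteq> v" "a \<noteq> b" and st: "s \<in> {0..1}" "t \<in> {0..1}"
  shows "\<bar>half_sum_min a b (edge_pt u v s) - half_sum_min a b (edge_pt u v t)\<bar> \<le>
    (if {u, v} = {a, b} then \<bar>s - t\<bar> else if u \<in> {a, b} \<or> v \<in> {a, b} then \<bar>s - t\<bar> / 2 else 0)"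
proof -
  have "\<bar>(1 - s) / 2 - (1 - t) / 2\<bar> = \<bar>s - t\<bar> / 2" "\<bar>s / 2 - t / 2\<bar> = \<bar>s - t\<bar> / 2"
    by (auto simp: abs_if diff_divide_distrib)
  moreover have "\<bar>1 / 2 + min s (1 - s) - (1 / 2 + min t (1 - t))\<bar> \<le> \<bar>s - t\<bar>" by linarith
  ultimately show ?thesis
    unfolding half_sum_min_edge_pt[OF assms(1,2) st(1)] half_sum_min_edge_pt[OF assms(1,2) st(2)]
    by (simp del: abs_divide)
qed

text \<open>The value is \<open>-1\<close> at the midpoint of \<open>{a, b}\<close> and
  \<open>1\<close> at that of \<open>{c, e}\<close>, so midpoints of disjoint edges are at distance
  at least \<open>2\<close>. An edge joining the two pairs receives slope at most
  \<open>1 / 2\<close> from each term; on \<open>{a, b}\<close> and on \<open>{c, e}\<close> one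
  term vanishes.\<close>

lemma lipschitz_between_midpoints:
  assumes "a \<noteq> b" "c \<noteq> e" "{a, b} \<inter> {c, e} = {}"
  shows "edge_lipschitz (\<lambda>z. half_sum_min c e z - half_sum_min a b z)"
  unfolding edge_lipschitz_def
proof (intro allI impI)
  fix u v and s t :: real
  assume e: "{u, v} \<in> E" and st: "s \<in> {0..1}" "t \<in> {0..1}"
  have uv: "u \<noteq> v" using edgeD[OF e] by simp
  have "{u, v} = {a, b} \<Longrightarrow> {u, v} \<noteq> {c, e} \<and> u \<notin> {c, e} \<and> v \<notin> {c, e}"
    "{u, v} = {c, e} \<Longrightarrow> {u, v} \<noteq> {a, b} \<and> u \<notin> {a, b} \<and> v \<notin> {a, b}"
    using assms by (auto simp: doubleton_eq_iff)
  then show "\<bar>half_sum_min c e (edge_pt u v s) - half_sum_min a b (edge_pt u v s) -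
      (half_sum_min c e (edge_pt u v t) - half_sum_min a b (edge_pt u v t))\<bar> \<le> \<bar>s - t\<bar>"
    using half_sum_min_diff[OF uv assms(1) st] half_sum_min_diff[OF uv assms(2) st]
    by (smt (verit) field_sum_of_halves)
qed

text \<open>A bigon is a triangle with a repeated vertex and a one-point third side, and that point
  also lies on \<open>w\<close>. The part of \<open>w\<close> in question is geodesic because it has
  the same ends and the same length as that of \<open>v\<close>.\<close>

lemma graph_delta_ge_bigon:
  assumes v: "walk v k" and w: "walk w l" and ab: "0 \<le> a" "a \<le> b" "b \<le> real k" "b \<le> real l"
    and ends: "walk_pt w a = walk_pt v a" "walk_pt w b = walk_pt v b"
    and dist: "b - a \<le> d (walk_pt v a) (walk_pt v b)"
    and t: "a \<le> t" "t \<le> b"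
    and far: "\<And>s. a \<le> s \<Longrightarrow> s \<le> b \<Longrightarrow> r \<le> d (walk_pt v t) (walk_pt w s)"
  shows "r \<le> graph_delta G"
proof -
  have pts: "walk_pt v a \<in> points G" "walk_pt v b \<in> points G"
    using walk_pt_in_points[OF v] ab by auto
  have A: "geo (walk_pt v a) (walk_pt v b) (walk_pt v ` {a..b})"
    using geodesic_walk[OF v ab(1-3) dist] .
  have B: "geo (walk_pt v b) (walk_pt v a) (walk_pt w ` {a..b})"
    using geodesic_sym[OF geodesic_walk[OF w ab(1,2,4)]] dist ends dist_sym by simp
  show ?thesis
    using geodesic_trivial[OF pts(1)] far t far[of a] ab
    by (intro graph_delta_ge[OF pts pts(1) A B, of "{walk_pt v a}" "walk_pt v t"])
      (auto simp: ends)
qed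

lemma graph_delta_4_cycle:
  assumes E: "{a, b} \<in> E" "{b, c} \<in> E" "{c, e} \<in> E" "{e, a} \<in> E" and ne: "a \<noteq> c" "b \<noteq> e"
  shows "1 \<le> graph_delta G"
\<comment> \<open>Times \<open>1/2\<close> and \<open>5/2\<close> give the midpoints of
  \<open>{a, b}\<close> and \<open>{c, e}\<close>; one walk passes through \<open>b, c\<close>, the
  other through \<open>a, e\<close>. The witness at time \<open>3/2\<close> is the midpoint of
  \<open>{b, c}\<close>. The cycle may have chords.\<close>
proof (rule graph_delta_ge_bigon[of "(!) [a, b, c, e]" 3 "(!) [b, a, e, c]" 3 "1/2" "5/2" "3/2"])
  have ne': "a \<noteq> b" "b \<noteq> c" "c \<noteq> e" "e \<noteq> a" using E edgeD by blast+
  show w: "walk ((!) [a, b, c, e]) 3" "walk ((!) [b, a, e, c]) 3"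
    using E edgeD[OF E(1)] by (auto simp: walk_def insert_commute less_Suc_eq numeral_3_eq_3)
  have x: "walk_pt ((!) [a, b, c, e]) (1/2) = edge_pt a b (1/2)"
    and y: "walk_pt ((!) [a, b, c, e]) (5/2) = edge_pt c e (1/2)"
    and p: "walk_pt ((!) [a, b, c, e]) (3/2) = edge_pt b c (1/2)"
    using walk_pt_eq[of 0 "1/2" "(!) [a, b, c, e]"] walk_pt_eq[of 2 "5/2" "(!) [a, b, c, e]"]
      walk_pt_eq[of 1 "3/2" "(!) [a, b, c, e]"] by (simp_all add: numeral_2_eq_2)
  show "walk_pt ((!) [b, a, e, c]) (1/2) = walk_pt ((!) [a, b, c, e]) (1/2)"
    "walk_pt ((!) [b, a, e, c]) (5/2) = walk_pt ((!) [a, b, c, e]) (5/2)"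
    using walk_pt_eq[of 0 "1/2" "(!) [b, a, e, c]"] walk_pt_eq[of 2 "5/2" "(!) [b, a, e, c]"]
    by (simp_all add: x y numeral_2_eq_2 edge_pt_swap[of b a] edge_pt_swap[of e c])
  let ?F = "\<lambda>z. half_sum_min c e z - half_sum_min a b z"
  have "\<bar>?F (edge_pt a b (1/2)) - ?F (edge_pt c e (1/2))\<bar> \<le> d (edge_pt a b (1/2)) (edge_pt c e (1/2))"
    using lipschitz_between_midpoints[of a b c e] ne ne' E
    by (intro dist_ge_lipschitz) (auto intro: edge_pt_in_points)
  then show "5/2 - 1/2 \<le> d (walk_pt ((!) [a, b, c, e]) (1/2)) (walk_pt ((!) [a, b, c, e]) (5/2))"
    unfolding x y using ne ne' by (simp add: half_sum_min_def edge_pt_def)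
  fix s :: real assume s: "1/2 \<le> s" "s \<le> 5/2"
  define q where "q = walk_pt ((!) [b, a, e, c]) s"
  let ?D = "\<lambda>z. 3 / 2 - z b - z c - min (z b) (z c)"
  have "q \<in> points G" unfolding q_def using walk_pt_in_points[OF w(2)] s by simp
  then have "\<bar>?D (edge_pt b c (1/2)) - ?D q\<bar> \<le> d (edge_pt b c (1/2)) q"
    using lipschitz_to_midpoint[of b c] ne' E by (intro dist_ge_lipschitz) (auto intro: edge_pt_in_points)
  moreover have "?D (edge_pt b c (1/2)) = 0" using ne' by (simp add: edge_pt_def)
  \<comment> \<open>On \<open>{a, e}\<close> the value is \<open>3 / 2\<close>; on the two half
    edges it is \<open>1 / 2\<close> plus the distance along the edge from \<open>b\<close> or
    \<open>c\<close>, which is at least \<open>1 / 2\<close>.\<close>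
  moreover have "1 \<le> ?D q"
  proof -
    consider "s \<le> 1" | "1 \<le> s" "s \<le> 2" | "2 \<le> s" by linarith
    then show ?thesis
    proof cases
      case 1
      then have "q = edge_pt b a s" using walk_pt_eq[of 0 s "(!) [b, a, e, c]"] s q_def by simp
      then show ?thesis using 1 s ne ne' by (simp add: edge_pt_def)
    next
      case 2
      then have "q = edge_pt a e (s - 1)" using walk_pt_eq[of 1 s "(!) [b, a, e, c]"] s q_def by simp
      then show ?thesis using ne ne' by (simp add: edge_pt_def)
    next
      case 3
      then have "q = edge_pt e c (s - 2)"
        using walk_pt_eq[of 2 s "(!) [b, a, e, c]"] s q_def by (simp add: numeral_2_eq_2)
      then show ?thesis using 3 s ne ne' by (simp add: edge_pt_def)
    qed
  qed
  ultimately show "1 \<le> d (walk_pt ((!) [a, b, c, e]) (3/2)) (walk_pt ((!) [b, a, e, c]) s)"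
    unfolding p q_def by linarith
qed auto

lemma graph_delta_3_cycle:
  assumes E: "{a, b} \<in> E" "{b, c} \<in> E" "{c, a} \<in> E"
  shows "3 / 4 \<le> graph_delta G"
\<comment> \<open>Both walks lead from \<open>a\<close> to the midpoint of \<open>{b, c}\<close>, at
  distance \<open>3/2\<close>; the witness is the middle of the first one.\<close>
proof (rule graph_delta_ge_bigon[of "(!) [a, b, c]" 2 "(!) [a, c, b]" 2 0 "3/2" "3/4"])
  have ne: "a \<noteq> b" "b \<noteq> c" "c \<noteq> a" using E edgeD by blast+
  show w: "walk ((!) [a, b, c]) 2" "walk ((!) [a, c, b]) 2"
    using E edgeD[OF E(1)] by (auto simp: walk_def insert_commute less_Suc_eq numeral_2_eq_2)
  have x: "walk_pt ((!) [a, b, c]) 0 = vtx a"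
    and y: "walk_pt ((!) [a, b, c]) (3/2) = edge_pt b c (1/2)"
    and p: "walk_pt ((!) [a, b, c]) (3/4) = edge_pt a b (3/4)"
    using walk_pt_nat[of "(!) [a, b, c]" 0] walk_pt_eq[of 1 "3/2" "(!) [a, b, c]"]
      walk_pt_eq[of 0 "3/4" "(!) [a, b, c]"] by simp_all
  show "walk_pt ((!) [a, c, b]) 0 = walk_pt ((!) [a, b, c]) 0"
    "walk_pt ((!) [a, c, b]) (3/2) = walk_pt ((!) [a, b, c]) (3/2)"
    using walk_pt_nat[of "(!) [a, c, b]" 0] walk_pt_eq[of 1 "3/2" "(!) [a, c, b]"]
    by (simp_all add: x y edge_pt_swap[of c b])
  let ?D = "\<lambda>z. 3 / 2 - z b - z c - min (z b) (z c)"
  have "\<bar>?D (vtx a) - ?D (edge_pt b c (1/2))\<bar> \<le> d (vtx a) (edge_pt b c (1/2))"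
    using lipschitz_to_midpoint[of b c] ne E edgeD
    by (intro dist_ge_lipschitz) (auto intro: edge_pt_in_points vertex_in_points)
  then show "3/2 - 0 \<le> d (walk_pt ((!) [a, b, c]) 0) (walk_pt ((!) [a, b, c]) (3/2))"
    unfolding x y using ne by (simp add: edge_pt_def)
  fix s :: real assume s: "0 \<le> s" "s \<le> 3/2"
  define q where "q = walk_pt ((!) [a, c, b]) s"
  let ?F = "\<lambda>z. min (3 / 4) (\<bar>z a - 1 / 4\<bar> + 1 - z a - z b)"
  have "q \<in> points G" unfolding q_def using walk_pt_in_points[OF w(2)] s by simp
  then have "\<bar>?F (edge_pt a b (3/4)) - ?F q\<bar> \<le> d (edge_pt a b (3/4)) q"
    using lipschitz_to_quarter_point[of a b] ne E by (intro dist_ge_lipschitz) (auto intro: edge_pt_in_points)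
  moreover have "?F (edge_pt a b (3/4)) = 0" using ne by (simp add: edge_pt_def)
  \<comment> \<open>On \<open>{a, c}\<close> the cut-off value is attained; on the half of
    \<open>{c, b}\<close> nearer to \<open>c\<close> the distance through \<open>b\<close> is at
    least \<open>1/2 + 1/4\<close>.\<close>
  moreover have "3 / 4 \<le> ?F q"
  proof (cases "s \<le> 1")
    case True
    then have "q = edge_pt a c s" using walk_pt_eq[of 0 s "(!) [a, c, b]"] s q_def by simp
    then show ?thesis using True s ne by (simp add: edge_pt_def abs_if)
  next
    case False
    then have "q = edge_pt c b (s - 1)" using walk_pt_eq[of 1 s "(!) [a, c, b]"] s q_def by simp
    then show ?thesis using s ne by (simp add: edge_pt_def)
  qed
  ultimately show "3 / 4 \<le> d (walk_pt ((!) [a, b, c]) (3/4)) (walk_pt ((!) [a, c, b]) s)"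
    unfolding p q_def by linarith
qed auto

end

section \<open>Breadth-first levels\<close>

context metric_graph
begin

context
  fixes r :: 'a
  assumes r: "r \<in> V"
begin

definition adj :: "('a \<times> 'a) set" where
  "adj = {(a, b). {a, b} \<in> E}"

definition level :: "'a \<Rightarrow> nat" where
  "level v = (LEAST k. (r, v) \<in> adj ^^ k)"

lemma level_reached: "v \<in> V \<Longrightarrow> (r, v) \<in> adj ^^ level v"
proof -
  assume "v \<in> V"
  then have "(r, v) \<in> adj\<^sup>*" using conn r by (simp add: connected_graph_def adj_def)
  then obtain k where "(r, v) \<in> adj ^^ k" using rtrancl_power by blast
  then show ?thesis unfolding level_def by (rule LeastI)
qed

lemma level_le: "(r, v) \<in> adj ^^ k \<Longrightarrow> level v \<le> k"
  unfolding level_def by (rule Least_le)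

lemma level_root: "level r = 0"
  using level_le[of r 0] by simp

lemma level_0_iff: "v \<in> V \<Longrightarrow> level v = 0 \<longleftrightarrow> v = r"
  using level_reached[of v] level_root by auto

lemma level_edge_le:
  assumes "{u, v} \<in> E"
  shows "level v \<le> Suc (level u)"
proof -
  have "(r, v) \<in> adj ^^ Suc (level u)"
    using level_reached[of u] edgeD[OF assms] assms by (auto simp: adj_def)
  then show ?thesis by (rule level_le)
qed

lemma level_edge_diff: "{u, v} \<in> E \<Longrightarrow> \<bar>real (level u) - real (level v)\<bar> \<le> 1"
  using level_edge_le[of u v] level_edge_le[of v u] by (simp add: insert_commute)

lemma parent_exists:
  assumes "v \<in> V" "v \<noteq> r"
  shows "\<exists>u. {u, v} \<in> E \<and> Suc (level u) = level v"
proof -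
  obtain k where k: "level v = Suc k" using level_0_iff[OF assms(1)] assms(2) not0_implies_Suc by blast
  then obtain u where u: "(r, u) \<in> adj ^^ k" "{u, v} \<in> E"
    using level_reached[OF assms(1)] by (auto simp: adj_def)
  then have "level u = k" using level_le[OF u(1)] level_edge_le[OF u(2)] k by simp
  then show ?thesis using u k by auto
qed

text \<open>Descent through parents. Since \<open>level (w i) = i\<close>, the walk has exactly one
  vertex on each level up to \<open>level v\<close>, which decides whether a given vertex lies on
  it.\<close>

lemma shortest_walk:
  assumes "v \<in> V"
  shows "\<exists>w. walk w (level v) \<and> w 0 = r \<and> w (level v) = v \<and> (\<forall>i\<le>level v. level (w i) = i)"
  using assms
proof (induction "level v" arbitrary: v)
  case 0
  then have "v = r" using level_0_iff by simp
  then show ?case using level_root r by (intro exI[of _ "\<lambda>_. r"]) (simp add: walk_def)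
next
  case (Suc k)
  then have "v \<noteq> r" using level_root by auto
  then obtain u where u: "{u, v} \<in> E" "Suc (level u) = level v" using parent_exists Suc by blast
  then have "k = level u" "u \<in> V" using Suc(2) edgeD by auto
  then obtain w where w: "walk w k" "w 0 = r" "w k = u" "\<forall>i\<le>k. level (w i) = i"
    using Suc(1)[of u] by auto
  define w' where "w' = w(Suc k := v)"
  have "walk w' (Suc k)" using w u unfolding walk_def w'_def by (auto simp: less_Suc_eq)
  moreover have "\<forall>i\<le>Suc k. level (w' i) = i" using w Suc(2) by (auto simp: w'_def le_Suc_eq)
  ultimately show ?case using w Suc(2) by (intro exI[of _ w']) (auto simp: w'_def)
qed

lemma shortest_walk_via_parent:
  assumes "{u, v} \<in> E" "Suc (level u) = level v"
  shows "\<exists>w. walk w (level v) \<and> w 0 = r \<and> w (level v) = v \<and> w (level u) = u \<and>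
    (\<forall>i\<le>level v. level (w i) = i)"
proof -
  obtain w where w: "walk w (level u)" "w 0 = r" "w (level u) = u" "\<forall>i\<le>level u. level (w i) = i"
    using shortest_walk[of u] edgeD[OF assms(1)] by blast
  define w' where "w' = w(Suc (level u) := v)"
  have "walk w' (Suc (level u))" using w assms(1) unfolding walk_def w'_def by (auto simp: less_Suc_eq)
  moreover have "\<forall>i\<le>Suc (level u). level (w' i) = i" using w assms(2) by (auto simp: w'_def le_Suc_eq)
  ultimately show ?thesis using w assms(2) by (intro exI[of _ w']) (auto simp: w'_def)
qed

text \<open>Levels change by at most \<open>1\<close> along an edge, so their affine extension is
  \<open>1\<close>-Lipschitz.\<close>

lemma dist_root_ge:
  assumes "v \<in> V"
  shows "real (level v) \<le> d (vtx r) (vtx v)"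
  using dist_ge_lipschitz[OF lin_ext_lipschitz[of "\<lambda>v. real (level v)"], of "vtx r" "vtx v"]
    level_edge_diff vertex_in_points[OF r] vertex_in_points[OF assms] r assms
  by (simp add: lin_ext_edge_pt level_root)

lemma shortest_walk_geo:
  assumes "walk w (level v)" "w 0 = r" "w (level v) = v" "v \<in> V"
  shows "geo (vtx r) (vtx v) (walk_pt w ` {0..real (level v)})"
  using geodesic_walk[OF assms(1), of 0 "real (level v)"] dist_root_ge[OF assms(4)]
    walk_pt_nat[of w 0] walk_pt_nat[of w "level v"] assms by simp

lemma walk_pt_coordinate_0:
  assumes "\<And>i. i \<le> k \<Longrightarrow> w i \<noteq> u" "0 \<le> t" "t \<le> real k"
  shows "walk_pt w t u = 0"
\<comment> \<open>At the final time \<open>walk_pt\<close> refers to \<open>w (Suc k)\<close>, about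
  which nothing is known.\<close>
proof (cases "t = real k")
  case True
  then show ?thesis using assms(1)[of k] by (simp add: walk_pt_nat edge_pt_def)
next
  case False
  then have k: "nat \<lfloor>t\<rfloor> < k" using assms by linarith
  then show ?thesis
    using assms(1)[of "nat \<lfloor>t\<rfloor>"] assms(1)[of "Suc (nat \<lfloor>t\<rfloor>)"] by (auto simp: walk_pt_def edge_pt_def)
qed

text \<open>A parent not on the other shortest walk has coordinate \<open>0\<close> along it, so its distance from that
  walk is at least \<open>1\<close>.\<close>

lemma dist_parent_shortest_walk:
  assumes "u \<in> V" "walk w k" "\<forall>i\<le>k. level (w i) = i" "level u \<le> k" "w (level u) \<noteq> u"
    and q: "q \<in> walk_pt w ` {0..real k}"
  shows "1 \<le> d (vtx u) q"
proof -
  obtain t where t: "0 \<le> t" "t \<le> real k" "q = walk_pt w t" using q by auto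
  have "w i \<noteq> u" if "i \<le> k" for i using assms(3-5) that by metis
  then have "q u = 0" using walk_pt_coordinate_0[of k w u t] t by simp
  moreover have "q \<in> points G" using walk_pt_in_points[OF assms(2)] t by simp
  ultimately show ?thesis using dist_vertex_ge_1[OF assms(1)] by blast
qed

lemma parent_on_walk:
  assumes "walk w (level v)" "w (level u) = u" "level u \<le> level v"
  shows "vtx u \<in> walk_pt w ` {0..real (level v)}"
  using assms walk_pt_nat[of w "level u"] by (intro image_eqI[of _ _ "real (level u)"]) auto

lemma graph_delta_two_parents:
  assumes u: "{u, v} \<in> E" "Suc (level u) = level v" and u': "{u', v} \<in> E" "Suc (level u') = level v"
    and "u \<noteq> u'"
  shows "1 \<le> graph_delta G"
proof -
  have V: "u \<in> V" "u' \<in> V" "v \<in> V" using edgeD u u' by blast+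
  obtain w where w: "walk w (level v)" "w 0 = r" "w (level v) = v" "w (level u) = u"
    using shortest_walk_via_parent[OF u] by blast
  obtain w' where w': "walk w' (level v)" "w' 0 = r" "w' (level v) = v" "w' (level u') = u'"
    "\<forall>i\<le>level v. level (w' i) = i"
    using shortest_walk_via_parent[OF u'] by blast
  have eq: "level u' = level u" using u u' by simp
  \<comment> \<open>On the level of \<open>u\<close> the second walk passes through
    \<open>u'\<close>, so it misses \<open>u\<close>.\<close>
  have far: "1 \<le> d (vtx u) q" if "q \<in> walk_pt w' ` {0..real (level v)}" for q
    using dist_parent_shortest_walk[OF V(1) w'(1,5) _ _ that] w'(4) assms(5) u(2) eq by simp
  have pts: "vtx r \<in> points G" "vtx v \<in> points G" using r V by (auto intro: vertex_in_points)
  have B: "geo (vtx v) (vtx r) (walk_pt w' ` {0..real (level v)})"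
    using geodesic_sym[OF shortest_walk_geo[OF w'(1-3) V(3)] dist_sym] .
  have "vtx r \<in> walk_pt w' ` {0..real (level v)}"
    using walk_pt_nat[of w' 0] w'(2) by (intro image_eqI[of _ _ 0]) auto
  then show ?thesis
    using far u(2)
    by (intro graph_delta_ge[OF pts pts(1) shortest_walk_geo[OF w(1-3) V(3)] B geodesic_trivial[OF pts(1)],
          of "vtx u"]) (auto intro: parent_on_walk[OF w(1,4)])
qed

text \<open>The edge is treated as a walk of length \<open>1\<close>, taken from the sequence
  \<open>u, v, v, ...\<close>.\<close>

lemma edge_geo:
  assumes "{u, v} \<in> E"
  shows "geo (vtx u) (vtx v) (walk_pt (case_nat u (\<lambda>_. v)) ` {0..1})"
proof -
  have V: "u \<in> V" "v \<in> V" "u \<noteq> v" using edgeD[OF assms] by auto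
  have "1 \<le> d (vtx u) (vtx v)"
    using V by (intro dist_vertex_ge_1 vertex_in_points) (auto simp: edge_pt_def)
  moreover have "walk (case_nat u (\<lambda>_. v)) 1" using V assms by (simp add: walk_def)
  ultimately show ?thesis
    using geodesic_walk[of "case_nat u (\<lambda>_. v)" 1 0 1] walk_pt_nat[of "case_nat u (\<lambda>_. v)" 0]
      walk_pt_nat[of "case_nat u (\<lambda>_. v)" 1] by simp
qed

lemma graph_delta_siblings:
  assumes e: "{v, v'} \<in> E" "level v' = level v"
    and u: "{u, v} \<in> E" "Suc (level u) = level v" and u': "{u', v'} \<in> E" "Suc (level u') = level v'"
    and "u \<noteq> u'"
  shows "1 \<le> graph_delta G"
proof -
  have V: "u \<in> V" "u' \<in> V" "v \<in> V" "v' \<in> V" using edgeD u u' by blast+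
  obtain w where w: "walk w (level v)" "w 0 = r" "w (level v) = v" "w (level u) = u"
    using shortest_walk_via_parent[OF u] by blast
  obtain w' where w': "walk w' (level v')" "w' 0 = r" "w' (level v') = v'" "w' (level u') = u'"
    "\<forall>i\<le>level v'. level (w' i) = i"
    using shortest_walk_via_parent[OF u'] by blast
  have eq: "level u' = level u" using u u' e(2) by simp
  have far: "1 \<le> d (vtx u) q" if "q \<in> walk_pt w' ` {0..real (level v')}" for q
    using dist_parent_shortest_walk[OF V(1) w'(1,5) _ _ that] w'(4) assms(7) u(2) eq e(2) by simp
  \<comment> \<open>Both ends of this edge lie one level beyond \<open>u\<close>, so the coordinate
    at \<open>u\<close> vanishes along it.\<close>
  have far': "1 \<le> d (vtx u) q" if q: "q \<in> walk_pt (case_nat v (\<lambda>_. v')) ` {0..1}" for q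
  proof -
    have "q \<in> points G" using geo_subset[OF edge_geo[OF e(1)]] q by blast
    moreover have "u \<noteq> v" "u \<noteq> v'" using u(2) e(2) by auto
    then have "q u = 0" using q walk_pt_coordinate_0[of 1 "case_nat v (\<lambda>_. v')" u]
      by (auto split: nat.split)
    ultimately show ?thesis using dist_vertex_ge_1[OF V(1)] by blast
  qed
  have pts: "vtx r \<in> points G" "vtx v \<in> points G" "vtx v' \<in> points G"
    using r V by (auto intro: vertex_in_points)
  have C: "geo (vtx v') (vtx r) (walk_pt w' ` {0..real (level v')})"
    using geodesic_sym[OF shortest_walk_geo[OF w'(1-3) V(4)] dist_sym] .
  show ?thesis
    using far far' u(2)
    by (intro graph_delta_ge[OF pts shortest_walk_geo[OF w(1-3) V(3)] edge_geo[OF e(1)] C, of "vtx u"])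
      (auto intro: parent_on_walk[OF w(1,4)])
qed

section \<open>Counting edges by levels\<close>

definition parent :: "'a \<Rightarrow> 'a" where
  "parent v = (SOME u. {u, v} \<in> E \<and> Suc (level u) = level v)"

lemma parent:
  assumes "v \<in> V" "v \<noteq> r"
  shows "{parent v, v} \<in> E" "Suc (level (parent v)) = level v"
  using someI_ex[OF parent_exists[OF assms]] unfolding parent_def by auto

definition sibling_edges :: "'a set set" where
  "sibling_edges = {{u, v} | u v. {u, v} \<in> E \<and> level u = level v}"

lemma sibling_not_root: "{u, v} \<in> E \<Longrightarrow> level u = level v \<Longrightarrow> u \<noteq> r \<and> v \<noteq> r"
  using edgeD[of u v] level_0_iff[of u] level_0_iff[of v] level_root by metis

text \<open>The levels of adjacent vertices differ by at most \<open>1\<close>, and an edge between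
  consecutive levels joins its end of higher level to the only parent of that end.\<close>

lemma edges_subset:
  assumes "graph_delta G < 1"
  shows "E \<subseteq> (\<lambda>v. {parent v, v}) ` (V - {r}) \<union> sibling_edges"
proof
  fix e assume "e \<in> E"
  then obtain u v where uv: "e = {u, v}" "{u, v} \<in> E" using edgeE by metis
  have up: "{a, b} \<in> (\<lambda>v. {parent v, v}) ` (V - {r})" if ab: "{a, b} \<in> E" "Suc (level a) = level b" for a b
  proof -
    have b: "b \<in> V" "b \<noteq> r" using edgeD ab level_root by auto
    have "parent b = a" using graph_delta_two_parents[OF parent[OF b] ab] assms by fastforce
    then show ?thesis using b by auto
  qed
  consider "level u = level v" | "Suc (level u) = level v" | "Suc (level v) = level u"
    using level_edge_le[of u v] level_edge_le[of v u] uv(2) by (force simp: insert_commute)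
  then show "e \<in> (\<lambda>v. {parent v, v}) ` (V - {r}) \<union> sibling_edges"
  proof cases
    case 1
    then show ?thesis using uv unfolding sibling_edges_def by blast
  next
    case 2
    then show ?thesis using up uv by simp
  next
    case 3
    then show ?thesis using up[of v u] uv by (simp add: insert_commute)
  qed
qed

lemma sibling_parent:
  assumes "graph_delta G < 1" "{u, v} \<in> E" "level u = level v"
  shows "parent u = parent v"
  using graph_delta_siblings[OF assms(2) assms(3)[symmetric] parent parent] sibling_not_root[OF assms(2,3)]
    edgeD[OF assms(2)] assms(1) by fastforce

text \<open>If \<open>{z, a}\<close> and \<open>{z, b}\<close> were two such edges, then
  \<open>a\<close>, \<open>z\<close>, \<open>b\<close> and their common parent would form a
  \<open>4\<close>-cycle.\<close>

lemma sibling_edges_disjoint: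
  assumes "graph_delta G < 1" "e \<in> sibling_edges" "e' \<in> sibling_edges" "e \<noteq> e'"
  shows "e \<inter> e' = {}"
proof (rule ccontr)
  assume "e \<inter> e' \<noteq> {}"
  then obtain z where "z \<in> e" "z \<in> e'" by blast
  then obtain a b where a: "e = {z, a}" "{z, a} \<in> E" "level z = level a"
    and b: "e' = {z, b}" "{z, b} \<in> E" "level z = level b"
    using assms(2,3) unfolding sibling_edges_def by (force simp: insert_commute)
  have V: "z \<in> V" "a \<in> V" "b \<in> V" "z \<noteq> r" "a \<noteq> r" "b \<noteq> r"
    using edgeD sibling_not_root a b by blast+
  have "{parent z, a} \<in> E" "{parent z, b} \<in> E"
    using sibling_parent[OF assms(1)] a b parent(1) V by metis+
  moreover have "parent z \<noteq> z" using edgeD[OF parent(1)[OF V(1,4)]] by simp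
  ultimately have "1 \<le> graph_delta G"
    using graph_delta_4_cycle[of a z b "parent z"] a b assms(4) by (auto simp: insert_commute)
  then show False using assms(1) by simp
qed

lemma finite_sibling_edges: "finite sibling_edges"
  using finite_subset[OF _ finite_E, of sibling_edges] unfolding sibling_edges_def by blast

text \<open>The sibling edges form a matching on \<open>V - {r}\<close>; the root is missed because
  it is alone on level \<open>0\<close>.\<close>

lemma card_sibling_edges:
  assumes "graph_delta G < 1"
  shows "2 * card sibling_edges \<le> card V - 1"
proof -
  have "card (\<Union> sibling_edges) = (\<Sum>e\<in>sibling_edges. card e)"
    using sibling_edges_disjoint[OF assms]
    by (intro card_Union_disjoint) (auto simp: pairwise_def disjnt_def sibling_edges_def)
  also have "\<dots> = (\<Sum>e\<in>sibling_edges. 2)"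
    using edgeD by (intro sum.cong) (auto simp: sibling_edges_def)
  finally have "2 * card sibling_edges = card (\<Union> sibling_edges)" by simp
  also have "\<dots> \<le> card (V - {r})"
    using finite_V edgeD sibling_not_root
    by (intro card_mono) (force simp: sibling_edges_def)+
  finally show ?thesis using r finite_V by simp
qed

lemma card_parent_edges: "card ((\<lambda>v. {parent v, v}) ` (V - {r})) \<le> card V - 1"
  using card_image_le[of "V - {r}" "\<lambda>v. {parent v, v}"] finite_V r by simp

lemma card_E_le:
  assumes "graph_delta G < 1"
  shows "card E \<le> card V - 1 + card sibling_edges"
proof -
  have "card E \<le> card ((\<lambda>v. {parent v, v}) ` (V - {r}) \<union> sibling_edges)"
    using edges_subset[OF assms] finite_V finite_sibling_edges by (intro card_mono) auto
  also have "\<dots> \<le> card ((\<lambda>v. {parent v, v}) ` (V - {r})) + card sibling_edges"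
    by (rule card_Un_le)
  finally show ?thesis using card_parent_edges by simp
qed

text \<open>A sibling edge and the common parent of its ends would form a
  \<open>3\<close>-cycle.\<close>

lemma sibling_edges_empty:
  assumes "graph_delta G < 3 / 4"
  shows "sibling_edges = {}"
proof (rule ccontr)
  assume "sibling_edges \<noteq> {}"
  then obtain u v where uv: "{u, v} \<in> E" "level u = level v" unfolding sibling_edges_def by blast
  have V: "u \<in> V" "v \<in> V" "u \<noteq> r" "v \<noteq> r" using edgeD sibling_not_root uv by blast+
  have "parent u = parent v" using sibling_parent uv assms by simp
  then have "{parent u, u} \<in> E" "{v, parent u} \<in> E"
    using parent(1)[of u] parent(1)[of v] V by (simp_all add: insert_commute)
  then have "3 / 4 \<le> graph_delta G" using graph_delta_3_cycle uv by blast
  then show False using assms by simp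
qed

end

lemma graph_delta_ge_3_4:
  assumes "card V \<le> card E"
  shows "3 / 4 \<le> graph_delta G"
proof (rule ccontr)
  assume "\<not> 3 / 4 \<le> graph_delta G"
  moreover obtain r where r: "r \<in> V" using conn by (auto simp: connected_graph_def)
  ultimately have "card E \<le> card V - 1"
    using card_E_le[OF r] sibling_edges_empty[OF r] by simp
  \<comment> \<open>Excludes the truncated case of \<open>card V - 1\<close>.\<close>
  moreover have "card V > 0" using r finite_V card_gt_0_iff by blast
  ultimately show False using assms by simp
qed

lemma graph_delta_ge_1:
  assumes "3 * card V - 3 < 2 * card E"
  shows "1 \<le> graph_delta G"
proof (rule ccontr)
  assume "\<not> 1 \<le> graph_delta G"
  moreover obtain r where r: "r \<in> V" using conn by (auto simp: connected_graph_def)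
  ultimately show False
    using card_E_le[OF r] card_sibling_edges[OF r] assms by simp
qed

end

section \<open>Extremal graphs\<close>

context metric_graph
begin

text \<open>\<open>F\<close> is a \<open>1\<close>-Lipschitz inverse of the parametrization, so
  distances are differences of parameters. The parameter of \<open>p\<close> lies between those of
  \<open>x\<close> and \<open>y\<close>, hence is also attained on the two other sides, and only
  \<open>p\<close> has it.\<close>

lemma graph_delta_le_path:
  assumes w: "walk w k" and onto: "\<And>x. x \<in> points G \<Longrightarrow> \<exists>t\<in>{0..real k}. x = walk_pt w t"
    and F: "edge_lipschitz F" "\<And>t. t \<in> {0..real k} \<Longrightarrow> F (walk_pt w t) = t"
  shows "graph_delta G \<le> 0"
proof (rule graph_delta_le)
  fix x y z A B C p
  assume xyz: "x \<in> points G" "y \<in> points G" "z \<in> points G"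
    and geo: "geo x y A" "geo y z B" "geo z x C" and p: "p \<in> A"
  have p': "p \<in> points G" using p geo_subset[OF geo(1)] by auto
  obtain a b c where abc: "a \<in> {0..real k}" "x = walk_pt w a" "b \<in> {0..real k}" "y = walk_pt w b"
    "c \<in> {0..real k}" "p = walk_pt w c"
    using onto[OF xyz(1)] onto[OF xyz(2)] onto[OF p'] by blast
  have Fabc: "F x = a" "F y = b" "F p = c" using F(2) abc by auto
  have "\<bar>a - c\<bar> + \<bar>c - b\<bar> \<le> d x p + d p y"
    using dist_ge_lipschitz[OF F(1) xyz(1) p'] dist_ge_lipschitz[OF F(1) p' xyz(2)] Fabc by simp
  also have "\<dots> = d x y" using geo_dist_add[OF geo(1) xyz(1,2) p] .
  also have "\<dots> \<le> \<bar>a - b\<bar>"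
    using walk_pt_dist_le[OF w, of a b] walk_pt_dist_le[OF w, of b a] abc dist_sym[of x y]
    by (cases "a \<le> b") auto
  finally have "a \<le> c \<and> c \<le> b \<or> b \<le> c \<and> c \<le> a" by linarith
  then obtain q where q: "q \<in> B \<union> C" "F q = c"
  proof
    assume "a \<le> c \<and> c \<le> b"
    then show ?thesis using geo_two_sides_ivt[OF geo(2,3) xyz F(1)] Fabc that by auto
  next
    assume "b \<le> c \<and> c \<le> a"
    then show ?thesis
      using geo_two_sides_ivt[OF geodesic_sym[OF geo(3) dist_sym] geodesic_sym[OF geo(2) dist_sym] xyz(2,1,3) F(1)]
        Fabc that by auto
  qed
  have q': "q \<in> points G" using q(1) geo_subset[OF geo(2)] geo_subset[OF geo(3)] by auto
  then have "q = p" using onto[OF q'] F(2) q(2) abc by auto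
  then show "\<exists>q\<in>B \<union> C. d p q \<le> 0" using q(1) dist_self[OF p'] by (intro bexI[of _ q]) auto
qed simp

text \<open>A point \<open>c\<close> separating \<open>x\<close> and \<open>y\<close> lies on every path between them, hence on the side
  \<open>[xy]\<close> and on the union of the two other sides.\<close>

lemma graph_delta_le_cut_vertex:
  assumes D: "3 / 2 \<le> D" and c: "c \<in> V"
    and near: "\<And>x. x \<in> points G \<Longrightarrow> d x (vtx c) \<le> 3 / 2"
    and pairs: "\<And>x y. x \<in> points G \<Longrightarrow> y \<in> points G \<Longrightarrow> d x y \<le> D \<or>
      (\<exists>F. edge_lipschitz F \<and> F x \<le> 0 \<and> 0 \<le> F y \<and> (\<forall>z\<in>points G. F z = 0 \<longrightarrow> z = vtx c))"
  shows "graph_delta G \<le> D / 2"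
proof (rule graph_delta_le)
  fix x y z A B C p
  assume xyz: "x \<in> points G" "y \<in> points G" "z \<in> points G"
    and geo: "geo x y A" "geo y z B" "geo z x C" and p: "p \<in> A"
  have ends: "x \<in> C" "y \<in> B" using geo_ends[OF geo(2)] geo_ends[OF geo(3)] xyz by auto
  show "\<exists>q\<in>B \<union> C. d p q \<le> D / 2"
  proof (cases "d x y \<le> D")
    case True
    then have "d p x \<le> D / 2 \<or> d p y \<le> D / 2"
      using geo_dist_add[OF geo(1) xyz(1,2) p] dist_sym[of p x] by linarith
    then show ?thesis using ends by blast
  next
    case False
    then obtain F where F: "edge_lipschitz F" "F x \<le> 0" "0 \<le> F y" "\<And>z. z \<in> points G \<Longrightarrow> F z = 0 \<Longrightarrow> z = vtx c"
      using pairs[OF xyz(1,2)] by blast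
    obtain q where "q \<in> A" "F q = 0" using geo_ivt[OF geo(1) xyz(1,2) F(1-3)] by blast
    then have A: "vtx c \<in> A" using F(4)[of q] geo_subset[OF geo(1)] by auto
    obtain q' where "q' \<in> B \<union> C" "F q' = 0" using geo_two_sides_ivt[OF geo(2,3) xyz F(1-3)] by blast
    then have BC: "vtx c \<in> B \<union> C" using F(4)[of q'] geo_subset[OF geo(2)] geo_subset[OF geo(3)] by auto
    \<comment> \<open>The vertex \<open>c\<close> cuts the side into two pieces of length at most
      \<open>3 / 2 \<le> D\<close>; \<open>p\<close> lies in one of them, within half its length of
      an end, and the ends of both pieces belong to \<open>B \<union> C\<close>.\<close>
    have "d x p + d p (vtx c) \<le> 3 / 2 \<or> d (vtx c) p + d p y \<le> 3 / 2"
      using geo_between[OF geo(1) xyz(1,2) p A] near[OF xyz(1)] near[OF xyz(2)] dist_sym[of "vtx c" y] by auto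
    then have "d p x \<le> D / 2 \<or> d p (vtx c) \<le> D / 2 \<or> d p y \<le> D / 2"
      using D dist_sym[of p x] dist_sym[of p "vtx c"] by linarith
    then show ?thesis using ends BC by blast
  qed
qed (use D in simp)

lemma dist_edge_le_1:
  assumes "{u, v} \<in> E"
  shows "d (vtx u) (vtx v) \<le> 1"
  using dist_segment[OF assms, of 0 1] by (simp add: edge_pt_0[of u v] edge_pt_1)

lemma dist_edge_pt_le:
  assumes "{u, v} \<in> E" "0 \<le> t" "t \<le> 1"
  shows "d (edge_pt u v t) (vtx u) \<le> t" "d (edge_pt u v t) (vtx v) \<le> 1 - t"
  using dist_segment[OF assms(1), of t 0] dist_segment[OF assms(1), of t 1] assms(2,3)
  by (simp_all add: edge_pt_0[of u v] edge_pt_1)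

text \<open>The two routes, through \<open>u, u'\<close> and through \<open>v, v'\<close>, have total length at most \<open>2 + K\<close>.\<close>

lemma dist_edge_pts_le:
  assumes e: "{u, v} \<in> E" "0 \<le> s" "s \<le> 1" and e': "{u', v'} \<in> E" "0 \<le> t" "t \<le> 1"
    and K: "d (vtx u) (vtx u') + d (vtx v) (vtx v') \<le> K"
  shows "d (edge_pt u v s) (edge_pt u' v' t) \<le> 1 + K / 2"
proof -
  let ?x = "edge_pt u v s" and ?y = "edge_pt u' v' t"
  have pts: "?x \<in> points G" "?y \<in> points G" "vtx u \<in> points G" "vtx v \<in> points G"
    "vtx u' \<in> points G" "vtx v' \<in> points G"
    using e e' edgeD by (auto intro: edge_pt_in_points vertex_in_points)
  have "d ?x ?y \<le> s + d (vtx u) (vtx u') + t"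
    using dist_triangle[OF pts(1,3,2)] dist_triangle[OF pts(3,5,2)] dist_edge_pt_le(1)[OF e]
      dist_edge_pt_le(1)[OF e'] dist_sym[of ?y "vtx u'"] by linarith
  moreover have "d ?x ?y \<le> (1 - s) + d (vtx v) (vtx v') + (1 - t)"
    using dist_triangle[OF pts(1,4,2)] dist_triangle[OF pts(4,6,2)] dist_edge_pt_le(2)[OF e]
      dist_edge_pt_le(2)[OF e'] dist_sym[of ?y "vtx v'"] by linarith
  ultimately show ?thesis using K by linarith
qed

text \<open>Without the apex no edge joins different blocks of \<open>\<beta>\<close>, so
  \<open>c\<close> separates points of different blocks. Two points of one block lie within
  \<open>1 + K / 2\<close> of each other by \<open>dist_edge_pts_le\<close>, the ends of their edges
  being matched in a suitable order. The values \<open>K = 1\<close> and \<open>K = 2\<close> yield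
  \<open>3 / 4\<close> and \<open>1\<close>.\<close>

lemma graph_delta_le_cone:
  fixes \<beta> :: "'a \<Rightarrow> 'b" and K :: real
  assumes K: "1 \<le> K" and c: "c \<in> V" and V: "V \<noteq> {c}"
    and apex: "\<And>v. v \<in> V \<Longrightarrow> v \<noteq> c \<Longrightarrow> {c, v} \<in> E"
    and block: "\<And>u v. {u, v} \<in> E \<Longrightarrow> u \<noteq> c \<Longrightarrow> v \<noteq> c \<Longrightarrow> \<beta> u = \<beta> v"
    and pairs: "\<And>u v u' v' b. {u, v} \<in> E \<Longrightarrow> {u', v'} \<in> E \<Longrightarrow> (\<And>w. w \<in> {u, v, u', v'} \<Longrightarrow> w \<noteq> c \<Longrightarrow> \<beta> w = b) \<Longrightarrow>
      d (vtx u) (vtx u') + d (vtx v) (vtx v') \<le> K \<or> d (vtx u) (vtx v') + d (vtx v) (vtx u') \<le> K"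
  shows "graph_delta G \<le> (1 + K / 2) / 2"
proof (rule graph_delta_le_cut_vertex[OF _ c])
  show "3 / 2 \<le> 1 + K / 2" using K by simp
  \<comment> \<open>The apex has a neighbour, so every vertex is the end of an edge and every point
    can be treated as an edge point.\<close>
  have pt_edge: "\<exists>u v t. {u, v} \<in> E \<and> 0 \<le> t \<and> t \<le> 1 \<and> x = edge_pt u v t" if "x \<in> points G" for x
    using that
  proof (cases rule: pointsE)
    case (vertex v)
    obtain u where "{v, u} \<in> E"
    proof (cases "v = c")
      case True
      then show ?thesis using V c apex that by blast
    next
      case False
      then show ?thesis using apex[OF vertex(1)] that[of c] by (simp add: insert_commute)
    qed
    then show ?thesis using vertex(2) edge_pt_0[of v u] by (intro exI[of _ v] exI[of _ u] exI[of _ 0]) simp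
  qed auto
  fix x assume x: "x \<in> points G"
  obtain u v t where uv: "{u, v} \<in> E" "0 \<le> t" "t \<le> 1" "x = edge_pt u v t" using pt_edge[OF x] by blast
  have le_1: "d (vtx w) (vtx c) \<le> 1" if "w \<in> V" for w
    using apex[OF that] dist_edge_le_1[of c w] dist_self[OF vertex_in_points[OF c]] dist_sym[of "vtx w" "vtx c"]
    by (cases "w = c") auto
  have pts: "vtx u \<in> points G" "vtx v \<in> points G" "vtx c \<in> points G"
    using edgeD[OF uv(1)] c by (auto intro: vertex_in_points)
  \<comment> \<open>The nearer end of the edge is at most \<open>1 / 2\<close> away, and the apex at
    most \<open>1\<close> from that end.\<close>
  show "d x (vtx c) \<le> 3 / 2"
    using dist_edge_pt_le[OF uv(1-3)] le_1[of u] le_1[of v] edgeD[OF uv(1)] uv(4)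
      dist_triangle[OF x pts(1,3)] dist_triangle[OF x pts(2,3)] by auto
  fix y assume y: "y \<in> points G"
  obtain u' v' s where uv': "{u', v'} \<in> E" "0 \<le> s" "s \<le> 1" "y = edge_pt u' v' s" using pt_edge[OF y] by blast
  \<comment> \<open>An edge at the apex belongs to the block of its other end.\<close>
  define b where "b = (if u = c then \<beta> v else \<beta> u)"
  define b' where "b' = (if u' = c then \<beta> v' else \<beta> u')"
  have b: "w \<noteq> c \<Longrightarrow> \<beta> w = b" if "w \<in> {u, v}" for w
    using that block[OF uv(1)] by (auto simp: b_def)
  have b': "w \<noteq> c \<Longrightarrow> \<beta> w = b'" if "w \<in> {u', v'}" for w
    using that block[OF uv'(1)] by (auto simp: b'_def)
  show "d x y \<le> 1 + K / 2 \<or> (\<exists>F. edge_lipschitz F \<and> F x \<le> 0 \<and> 0 \<le> F y \<and>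
      (\<forall>z\<in>points G. F z = 0 \<longrightarrow> z = vtx c))"
  proof (cases "b = b'")
    case True
    then have "d (vtx u) (vtx u') + d (vtx v) (vtx v') \<le> K \<or> d (vtx u) (vtx v') + d (vtx v) (vtx u') \<le> K"
      using b b' by (intro pairs[OF uv(1) uv'(1), of b]) auto
    then have "d x y \<le> 1 + K / 2"
    proof
      assume "d (vtx u) (vtx u') + d (vtx v) (vtx v') \<le> K"
      then show ?thesis using dist_edge_pts_le[OF uv(1-3) uv'(1-3)] uv(4) uv'(4) by simp
    next
      assume *: "d (vtx u) (vtx v') + d (vtx v) (vtx u') \<le> K"
      \<comment> \<open>The crossed matching is the straight one with the second edge read
        backwards.\<close>
      have "{v', u'} \<in> E" "0 \<le> 1 - s" "1 - s \<le> 1" using uv' by (auto simp: insert_commute)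
      then show ?thesis
        using dist_edge_pts_le[OF uv(1-3) _ _ _ *] uv(4) uv'(4) edge_pt_swap[of u' v'] by metis
    qed
    then show ?thesis ..
  next
    case False
    \<comment> \<open>The extension is \<open>-1\<close> along edges inside block \<open>b\<close>,
      \<open>1\<close> along edges inside the other blocks, and on the edges at the apex it vanishes
      only at the apex.\<close>
    define \<phi> :: "'a \<Rightarrow> real" where "\<phi> w = (if w = c then 0 else if \<beta> w = b then - 1 else 1)" for w
    have F: "lin_ext \<phi> (edge_pt u v t) = (1 - t) * \<phi> u + t * \<phi> v" if "{u, v} \<in> E" for u v t
      using edgeD[OF that] by (simp add: lin_ext_edge_pt)
    have "edge_lipschitz (lin_ext \<phi>)"
      using block by (intro lin_ext_lipschitz) (auto simp: \<phi>_def)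
    moreover have "\<phi> u \<le> 0" "\<phi> v \<le> 0" using b by (auto simp: \<phi>_def)
    then have "lin_ext \<phi> x \<le> 0"
      using F[OF uv(1)] uv(2-4) by (simp add: add_nonpos_nonpos mult_nonneg_nonpos)
    moreover have "0 \<le> \<phi> u'" "0 \<le> \<phi> v'" using b' False by (auto simp: \<phi>_def)
    then have "0 \<le> lin_ext \<phi> y" using F[OF uv'(1)] uv'(2-4) by simp
    moreover have "z = vtx c" if z: "z \<in> points G" and 0: "lin_ext \<phi> z = 0" for z
    proof -
      obtain u v t where uv: "{u, v} \<in> E" "0 \<le> t" "t \<le> 1" "z = edge_pt u v t" using pt_edge[OF z] by blast
      have eq: "(1 - t) * \<phi> u + t * \<phi> v = 0" using F[OF uv(1)] 0 uv(4) by simp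
      consider "u = c" "v \<noteq> c" | "u \<noteq> c" "v = c" | "u \<noteq> c" "v \<noteq> c" using edgeD[OF uv(1)] by blast
      then show ?thesis
      proof cases
        case 1
        then have "t = 0" using eq by (auto simp: \<phi>_def split: if_splits)
        then show ?thesis using 1 uv(4) edge_pt_0 by simp
      next
        case 2
        then have "t = 1" using eq by (auto simp: \<phi>_def split: if_splits)
        then show ?thesis using 2 uv(4) edge_pt_1 by simp
      next
        case 3
        then have "\<phi> u = \<phi> v" "\<phi> u \<noteq> 0" using block[OF uv(1)] by (auto simp: \<phi>_def)
        then show ?thesis using eq by (simp add: algebra_simps)
      qed
    qed
    ultimately show ?thesis by blast
  qed
qed

end

lemma connected_graphI:
  assumes "c \<in> fst G" "\<And>v. v \<in> fst G \<Longrightarrow> (c, v) \<in> {(a, b). {a, b} \<in> snd G}\<^sup>*"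
  shows "connected_graph G"
proof -
  have "sym ({(a, b). {a, b} \<in> snd G}\<^sup>*)"
    by (intro sym_rtrancl) (auto simp: sym_def insert_commute)
  then have "(u, v) \<in> {(a, b). {a, b} \<in> snd G}\<^sup>*" if "u \<in> fst G" "v \<in> fst G" for u v
    using assms(2)[OF that(1)] assms(2)[OF that(2)] by (meson rtrancl_trans symD)
  then show ?thesis using assms(1) unfolding connected_graph_def by auto
qed

lemma metric_graph_of_graphs: "G \<in> graphs n m \<Longrightarrow> metric_graph G"
  by (simp add: graphs_def metric_graph_def)

section \<open>Concrete paths and cones\<close>

definition path_graph :: "nat \<Rightarrow> nat graph" where
  "path_graph n = ({..<n}, (\<lambda>i. {i, Suc i}) ` {..<n - 1})"

lemma path_graph_in_graphs:
  assumes "n \<ge> 1"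
  shows "path_graph n \<in> graphs n (n - 1)"
proof -
  have "simple_graph (path_graph n)"
    by (force simp: simple_graph_def path_graph_def)
  moreover have "connected_graph (path_graph n)"
  proof (rule connected_graphI[of 0])
    show "(0, v) \<in> {(a, b). {a, b} \<in> snd (path_graph n)}\<^sup>*" if "v \<in> fst (path_graph n)" for v
      using that
    proof (induction v)
      case (Suc v)
      then have "(0, v) \<in> {(a, b). {a, b} \<in> snd (path_graph n)}\<^sup>*" by (simp add: path_graph_def)
      moreover have "{v, Suc v} \<in> snd (path_graph n)" using Suc.prems by (auto simp: path_graph_def)
      ultimately show ?case by (simp add: rtrancl_into_rtrancl)
    qed simp
  qed (use assms in \<open>simp add: path_graph_def\<close>)
  moreover have "inj_on (\<lambda>i. {i, Suc i}) {..<n - 1}"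
    by (auto simp: inj_on_def doubleton_eq_iff)
  then have "card (snd (path_graph n)) = n - 1" by (simp add: path_graph_def card_image)
  ultimately show ?thesis by (simp add: graphs_def path_graph_def)
qed

lemma graph_delta_path_graph:
  assumes "n \<ge> 1"
  shows "graph_delta (path_graph n) \<le> 0"
proof -
  interpret metric_graph "path_graph n"
    using metric_graph_of_graphs[OF path_graph_in_graphs[OF assms]] .
  have V: "fst (path_graph n) = {..<n}" by (simp add: path_graph_def)
  have E: "{i, Suc i} \<in> snd (path_graph n) \<longleftrightarrow> i < n - 1" for i
    by (auto simp: path_graph_def doubleton_eq_iff)
  have w: "walk id (n - 1)" using assms V E by (simp add: walk_def)
  have step: "edge_pt i (Suc i) t = walk_pt id (real i + t)" if "0 \<le> t" "t \<le> 1" for i t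
    using walk_pt_eq[of i "real i + t" id] that by simp
  show ?thesis
  proof (rule graph_delta_le_path[OF w])
    fix x assume "x \<in> points (path_graph n)"
    then show "\<exists>t\<in>{0..real (n - 1)}. x = walk_pt id t"
    proof (cases rule: pointsE)
      case (vertex v)
      then show ?thesis using walk_pt_nat[of id v] V by (intro bexI[of _ "real v"]) auto
    next
      case (edge u v t)
      then consider "v = Suc u" "u < n - 1" | "u = Suc v" "v < n - 1"
        by (auto simp: path_graph_def doubleton_eq_iff)
      then show ?thesis
      proof cases
        case 1
        then show ?thesis using edge step[of t u] by (intro bexI[of _ "real u + t"]) auto
      next
        case 2
        then show ?thesis using edge step[of "1 - t" v] edge_pt_swap[of u v t]
          by (intro bexI[of _ "real v + (1 - t)"]) auto
      qed
    qed
  next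
    have "\<bar>real u - real v\<bar> \<le> 1" if "{u, v} \<in> snd (path_graph n)" for u v
      using that by (auto simp: path_graph_def doubleton_eq_iff)
    then show "edge_lipschitz (lin_ext real)" by (rule lin_ext_lipschitz)
    fix t assume t: "t \<in> {0..real (n - 1)}"
    show "lin_ext real (walk_pt id t) = t"
    \<comment> \<open>At the last time \<open>walk_pt\<close> refers to the vertex \<open>n\<close>,
      which is not in the graph, so this point is read as a vertex.\<close>
    proof (cases "t = real (n - 1)")
      case True
      then show ?thesis using walk_pt_nat[of id "n - 1"] assms V by (simp add: lin_ext_edge_pt)
    next
      case False
      then have "nat \<lfloor>t\<rfloor> < n - 1" using t by (simp, linarith)
      then show ?thesis using t V by (simp add: walk_pt_def lin_ext_edge_pt frac_def algebra_simps)
    qed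
  qed
qed

definition cone :: "nat \<Rightarrow> nat set set \<Rightarrow> nat graph" where
  "cone n H = ({..<n}, (\<lambda>v. {0, v}) ` {1..<n} \<union> H)"

lemma cone_in_graphs:
  assumes "n \<ge> 1" and H: "\<And>e. e \<in> H \<Longrightarrow> \<exists>u v. e = {u, v} \<and> u \<noteq> v \<and> {u, v} \<subseteq> {1..<n}"
  shows "cone n H \<in> graphs n (n - 1 + card H)"
proof -
  have "simple_graph (cone n H)"
    unfolding simple_graph_def
  proof safe
    fix e assume "e \<in> snd (cone n H)"
    then consider v where "v \<in> {1..<n}" "e = {0, v}" | "e \<in> H" by (auto simp: cone_def)
    then show "\<exists>u v. e = {u, v} \<and> u \<in> fst (cone n H) \<and> v \<in> fst (cone n H) \<and> u \<noteq> v"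
    proof cases
      case 1
      then show ?thesis by (intro exI[of _ 0] exI[of _ v]) (auto simp: cone_def)
    next
      case 2
      then obtain u v where "e = {u, v}" "u \<noteq> v" "{u, v} \<subseteq> {1..<n}" using H by blast
      then show ?thesis by (intro exI[of _ u] exI[of _ v]) (auto simp: cone_def)
    qed
  qed (simp add: cone_def)
  moreover have "connected_graph (cone n H)"
  proof (rule connected_graphI[of 0])
    fix v assume "v \<in> fst (cone n H)"
    then have "v = 0 \<or> {0, v} \<in> snd (cone n H)" by (auto simp: cone_def)
    then show "(0, v) \<in> {(a, b). {a, b} \<in> snd (cone n H)}\<^sup>*" by auto
  qed (use assms in \<open>simp add: cone_def\<close>)
  moreover have "card (snd (cone n H)) = n - 1 + card H"
  proof -
    have e: "e \<subseteq> {1..<n}" if eH: "e \<in> H" for e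
    proof -
      obtain u v where "e = {u, v}" "{u, v} \<subseteq> {1..<n}" using H[OF eH] by blast
      then show ?thesis by simp
    qed
    then have "H \<subseteq> Pow {1..<n}" by blast
    then have "finite H" using finite_subset by auto
    moreover have "(\<lambda>v. {0, v}) ` {1..<n} \<inter> H = {}" using e[of "{0, v}" for v] by fastforce
    moreover have "inj_on (\<lambda>v. {0, v}) {1..<n}" by (auto simp: inj_on_def doubleton_eq_iff)
    ultimately show ?thesis by (simp add: cone_def card_Un_disjoint card_image)
  qed
  ultimately show ?thesis by (simp add: graphs_def cone_def)
qed

text \<open>Each block of \<open>\<beta>\<close> carries a complete multipartite graph whose parts
  are the colour classes of \<open>f\<close>; \<open>f = id\<close> makes the blocks
  complete.\<close>

definition block_edges :: "nat \<Rightarrow> (nat \<Rightarrow> nat) \<Rightarrow> (nat \<Rightarrow> nat) \<Rightarrow> nat set set" where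
  "block_edges n \<beta> f = {{u, v} | u v. u \<in> {1..<n} \<and> v \<in> {1..<n} \<and> \<beta> u = \<beta> v \<and> f u \<noteq> f v}"

lemma cone_block_in_graphs:
  "n \<ge> 1 \<Longrightarrow> cone n (block_edges n \<beta> f) \<in> graphs n (n - 1 + card (block_edges n \<beta> f))"
  by (rule cone_in_graphs) (auto simp: block_edges_def)

lemma cone_block_edge_iff:
  "{u, v} \<in> snd (cone n (block_edges n \<beta> f)) \<longleftrightarrow>
     u < n \<and> v < n \<and> u \<noteq> v \<and> (u = 0 \<or> v = 0 \<or> \<beta> u = \<beta> v \<and> f u \<noteq> f v)"
proof -
  have "{u, v} \<in> block_edges n \<beta> f \<longleftrightarrow> u \<in> {1..<n} \<and> v \<in> {1..<n} \<and> \<beta> u = \<beta> v \<and> f u \<noteq> f v"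
    unfolding block_edges_def by (auto simp: doubleton_eq_iff intro: exI[of _ u])
  moreover have "{u, v} \<in> (\<lambda>w. {0, w}) ` {1..<n} \<longleftrightarrow> u = 0 \<and> v \<in> {1..<n} \<or> v = 0 \<and> u \<in> {1..<n}"
    by (auto simp: doubleton_eq_iff)
  ultimately show ?thesis by (auto simp: cone_def)
qed

lemma graph_delta_cone_block_le:
  fixes K :: real
  assumes n: "n \<ge> 2" and K: "1 \<le> K"
    and pairs: "\<And>u v u' v' b. {u, v} \<in> snd (cone n (block_edges n \<beta> f)) \<Longrightarrow>
      {u', v'} \<in> snd (cone n (block_edges n \<beta> f)) \<Longrightarrow>
      (\<And>w. w \<in> {u, v, u', v'} \<Longrightarrow> w \<noteq> 0 \<Longrightarrow> \<beta> w = b) \<Longrightarrow>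
      graph_dist (cone n (block_edges n \<beta> f)) (edge_pt u u 0) (edge_pt u' u' 0) +
      graph_dist (cone n (block_edges n \<beta> f)) (edge_pt v v 0) (edge_pt v' v' 0) \<le> K \<or>
      graph_dist (cone n (block_edges n \<beta> f)) (edge_pt u u 0) (edge_pt v' v' 0) +
      graph_dist (cone n (block_edges n \<beta> f)) (edge_pt v v 0) (edge_pt u' u' 0) \<le> K"
  shows "graph_delta (cone n (block_edges n \<beta> f)) \<le> (1 + K / 2) / 2"
proof -
  let ?G = "cone n (block_edges n \<beta> f)"
  have "?G \<in> graphs n (n - 1 + card (block_edges n \<beta> f))" using cone_block_in_graphs n by simp
  then interpret metric_graph ?G by (rule metric_graph_of_graphs)
  have V: "fst ?G = {..<n}" by (simp add: cone_def)
  show ?thesis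
  proof (rule graph_delta_le_cone[of K 0 \<beta>, OF K])
    have "1 \<in> fst ?G" using V n by simp
    then show "fst ?G \<noteq> {0}" by auto
  qed (use V n pairs in \<open>auto simp: cone_block_edge_iff\<close>)
qed

text \<open>Two edges of a complete multipartite graph have ends that are adjacent in pairs.\<close>

lemma graph_delta_multipartite_cone:
  assumes n: "n \<ge> 2"
  shows "graph_delta (cone n (block_edges n \<beta> f)) \<le> 1"
proof -
  let ?G = "cone n (block_edges n \<beta> f)"
  have "?G \<in> graphs n (n - 1 + card (block_edges n \<beta> f))" using cone_block_in_graphs n by simp
  then interpret metric_graph ?G by (rule metric_graph_of_graphs)
  have "graph_delta ?G \<le> (1 + 2 / 2) / 2"
  proof (rule graph_delta_cone_block_le[OF n])
    fix u v u' v' b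
    assume e: "{u, v} \<in> E" "{u', v'} \<in> E" and b: "\<And>w. w \<in> {u, v, u', v'} \<Longrightarrow> w \<noteq> 0 \<Longrightarrow> \<beta> w = b"
    \<comment> \<open>The apex receives a colour of its own, so that a block together with the apex
      is again complete multipartite.\<close>
    define g where "g w = (if w = 0 then 0 else Suc (f w))" for w
    have le_1: "d (vtx x) (vtx y) \<le> 1" if "x \<in> {u, v, u', v'}" "y \<in> {u, v, u', v'}" "g x \<noteq> g y" for x y
    proof (rule dist_edge_le_1)
      have "x < n" "y < n" using that e by (auto simp: cone_block_edge_iff)
      then show "{x, y} \<in> E" using that b[OF that(1)] b[OF that(2)]
        by (auto simp: cone_block_edge_iff g_def split: if_splits)
    qed
    have g: "g u \<noteq> g v" "g u' \<noteq> g v'" using e by (auto simp: cone_block_edge_iff g_def)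
    \<comment> \<open>If the straight matching meets equal colours, the crossed one does
      not.\<close>
    show "d (vtx u) (vtx u') + d (vtx v) (vtx v') \<le> 2 \<or> d (vtx u) (vtx v') + d (vtx v) (vtx u') \<le> 2"
    proof (cases "g u = g u' \<or> g v = g v'")
      case True
      then have "g u \<noteq> g v'" "g v \<noteq> g u'" using g by auto
      then show ?thesis using le_1[of u v'] le_1[of v u'] by auto
    next
      case False
      then show ?thesis using le_1[of u u'] le_1[of v v'] by auto
    qed
  qed simp
  then show ?thesis by simp
qed

text \<open>A block has at most two vertices besides the apex and forms with it at most a triangle,
  in which any two edges meet. One distance in a suitable sum is then \<open>0\<close> and the other
  at most \<open>1\<close>, so \<open>K = 1\<close> suffices.\<close>

lemma graph_delta_friendship:
  assumes n: "n \<ge> 2" and size: "\<And>x y z. x \<noteq> 0 \<Longrightarrow> y \<noteq> 0 \<Longrightarrow> z \<noteq> 0 \<Longrightarrow> \<beta> x = \<beta> y \<Longrightarrow> \<beta> y = \<beta> z \<Longrightarrow>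
    x = y \<or> y = z \<or> x = z"
  shows "graph_delta (cone n (block_edges n \<beta> id)) \<le> 3 / 4"
proof -
  let ?G = "cone n (block_edges n \<beta> id)"
  have "?G \<in> graphs n (n - 1 + card (block_edges n \<beta> id))" using cone_block_in_graphs n by simp
  then interpret metric_graph ?G by (rule metric_graph_of_graphs)
  have "graph_delta ?G \<le> (1 + 1 / 2) / 2"
  proof (rule graph_delta_cone_block_le[OF n])
    fix u v u' v' b
    assume e: "{u, v} \<in> E" "{u', v'} \<in> E" and b: "\<And>w. w \<in> {u, v, u', v'} \<Longrightarrow> w \<noteq> 0 \<Longrightarrow> \<beta> w = b"
    have V: "w \<in> V" if "w \<in> {u, v, u', v'}" for w using that edgeD e by blast
    have le_1: "d (vtx x) (vtx y) \<le> 1" if xy: "x \<in> {u, v, u', v'}" "y \<in> {u, v, u', v'}" for x y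
    proof (cases "x = y")
      case True
      then show ?thesis using dist_self[OF vertex_in_points[OF V[OF xy(1)]]] by simp
    next
      case False
      have "x < n" "y < n" using xy e by (auto simp: cone_block_edge_iff)
      moreover have "x = 0 \<or> y = 0 \<or> \<beta> x = \<beta> y" using b[OF xy(1)] b[OF xy(2)] by metis
      ultimately show ?thesis using False
        by (intro dist_edge_le_1) (simp add: cone_block_edge_iff)
    qed
    have self: "d (vtx w) (vtx w) = 0" if "w \<in> {u, v, u', v'}" for w
      using dist_self[OF vertex_in_points[OF V[OF that]]] .
    have ne: "u \<noteq> v" "u' \<noteq> v'" using e by (auto simp: cone_block_edge_iff)
    have \<beta>: "x = y \<or> y = z \<or> x = z" if "x \<in> {u, v, u', v'} - {0}" "y \<in> {u, v, u', v'} - {0}" "z \<in> {u, v, u', v'} - {0}" for x y z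
      using size[of x y z] b[of x] b[of y] b[of z] that by auto
    have "u = u' \<or> v = v' \<or> u = v' \<or> v = u'"
      using ne \<beta>[of u v u'] \<beta>[of u v v'] \<beta>[of u u' v'] \<beta>[of v u' v'] by auto
    then show "d (vtx u) (vtx u') + d (vtx v) (vtx v') \<le> 1 \<or> d (vtx u) (vtx v') + d (vtx v) (vtx u') \<le> 1"
      using self[of u] self[of v] le_1[of u u'] le_1[of v v'] le_1[of u v'] le_1[of v u'] by auto
  qed simp
  then show ?thesis by simp
qed

section \<open>Realizing a prescribed number of edges\<close>

lemma friendship_graph_exists:
  assumes "n \<ge> 2" "2 * k \<le> n - 1"
  shows "\<exists>G\<in>graphs n (n - 1 + k). graph_delta G \<le> 3 / 4"
proof -
  \<comment> \<open>Apart from the apex, the blocks are \<open>{1, 2}\<close>,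
    \<open>{3, 4}\<close>, ..., \<open>{2 * k - 1, 2 * k}\<close>, followed by singletons whose
    labels exceed \<open>2 * k\<close> and collide with no other.\<close>
  define \<beta> where "\<beta> w = (if w \<le> 2 * k then (w - 1) div 2 else w)" for w :: nat
  have "block_edges n \<beta> id = (\<lambda>i. {Suc (2 * i), Suc (Suc (2 * i))}) ` {..<k}"
  proof (intro equalityI subsetI)
    fix e assume "e \<in> block_edges n \<beta> id"
    then obtain a b where ab: "e = {a, b}" "a \<in> {1..<n}" "b \<in> {1..<n}" "\<beta> a = \<beta> b" "a \<noteq> b"
      by (auto simp: block_edges_def)
    \<comment> \<open>Ordering the ends makes the smaller one the odd member of its pair.\<close>
    define u v where "u = min a b" and "v = max a b"
    have uv: "e = {u, v}" "u \<noteq> 0" "\<beta> u = \<beta> v" "u < v" using ab by (auto simp: u_def v_def min_def max_def)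
    then have v: "v \<le> 2 * k" "(u - 1) div 2 = (v - 1) div 2" by (auto simp: \<beta>_def split: if_splits)
    define j where "j = (u - 1) div 2"
    have "u - 1 = 2 * j \<or> u - 1 = 2 * j + 1" "v - 1 = 2 * j \<or> v - 1 = 2 * j + 1"
      using v(2) unfolding j_def by linarith+
    then have "u = Suc (2 * j)" "v = Suc (Suc (2 * j))" "j < k"
      using uv(2,4) v(1) by linarith+
    then show "e \<in> (\<lambda>i. {Suc (2 * i), Suc (Suc (2 * i))}) ` {..<k}" using uv(1) by blast
  next
    fix e assume "e \<in> (\<lambda>i. {Suc (2 * i), Suc (Suc (2 * i))}) ` {..<k}"
    then obtain i where i: "i < k" "e = {Suc (2 * i), Suc (Suc (2 * i))}" by blast
    moreover have "\<beta> (Suc (2 * i)) = \<beta> (Suc (Suc (2 * i)))" using i by (auto simp: \<beta>_def)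
    ultimately show "e \<in> block_edges n \<beta> id" using assms(2) unfolding block_edges_def
      by (intro CollectI exI[of _ "Suc (2 * i)"] exI[of _ "Suc (Suc (2 * i))"]) auto
  qed
  moreover have "inj_on (\<lambda>i. {Suc (2 * i), Suc (Suc (2 * i))}) {..<k}"
    by (auto simp: inj_on_def doubleton_eq_iff)
  ultimately have "card (block_edges n \<beta> id) = k" by (simp add: card_image)
  then have "cone n (block_edges n \<beta> id) \<in> graphs n (n - 1 + k)"
    using cone_block_in_graphs[of n \<beta> id] assms(1) by simp
  moreover have "x = y \<or> y = z \<or> x = z"
    if "x \<noteq> 0" "y \<noteq> 0" "z \<noteq> 0" "\<beta> x = \<beta> y" "\<beta> y = \<beta> z" for x y z
  proof -
    have *: "a \<le> 2 * k \<and> b \<le> 2 * k \<and> (a - 1) div 2 = (b - 1) div 2 \<or> a = b" if "\<beta> a = \<beta> b" for a b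
      using that by (cases "a \<le> 2 * k"; cases "b \<le> 2 * k") (auto simp: \<beta>_def)
    show ?thesis using *[OF that(4)] *[OF that(5)] that(1-3) by linarith
  qed
  then have "graph_delta (cone n (block_edges n \<beta> id)) \<le> 3 / 4"
    using graph_delta_friendship[OF assms(1)] by blast
  ultimately show ?thesis by blast
qed

text \<open>These pairs are the non-edges of the complete multipartite graph on
  \<open>{..<q}\<close> with colouring \<open>f\<close>.\<close>

definition mono_pairs :: "(nat \<Rightarrow> nat) \<Rightarrow> nat \<Rightarrow> nat set set" where
  "mono_pairs f q = {e. e \<subseteq> {..<q} \<and> card e = 2 \<and> (\<exists>c. \<forall>i\<in>e. f i = c)}"

text \<open>Shifting the old colours by \<open>Suc\<close> frees colour \<open>0\<close> for the
  \<open>s\<close> new vertices, so a monochromatic pair is either old or consists of two new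
  vertices.\<close>

lemma mono_pairs_add_class:
  "\<exists>f'. card (mono_pairs f' (q + s)) = card (mono_pairs f q) + (s choose 2)"
proof -
  define f' where "f' i = (if i < q then Suc (f i) else 0)" for i
  have "mono_pairs f' (q + s) = mono_pairs f q \<union> {e. e \<subseteq> {q..<q + s} \<and> card e = 2}"
  proof (intro equalityI subsetI)
    fix e assume "e \<in> mono_pairs f' (q + s)"
    then obtain c where e: "e \<subseteq> {..<q + s}" "card e = 2" "\<And>i. i \<in> e \<Longrightarrow> f' i = c"
      by (auto simp: mono_pairs_def)
    show "e \<in> mono_pairs f q \<union> {e. e \<subseteq> {q..<q + s} \<and> card e = 2}"
    proof (cases "\<exists>i\<in>e. i < q")
      case True
      then obtain i where "i \<in> e" "i < q" by blast
      then have "c = Suc (f i)" using e(3)[of i] by (simp add: f'_def)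
      then have "j < q \<and> f j = f i" if "j \<in> e" for j using e(3)[OF that] by (auto simp: f'_def split: if_splits)
      then show ?thesis using e(2) by (auto simp: mono_pairs_def)
    next
      case False
      then have "e \<subseteq> {q..<q + s}" using e(1) by fastforce
      then show ?thesis using e(2) by blast
    qed
  next
    fix e assume "e \<in> mono_pairs f q \<union> {e. e \<subseteq> {q..<q + s} \<and> card e = 2}"
    then show "e \<in> mono_pairs f' (q + s)"
    proof
      assume "e \<in> mono_pairs f q"
      then obtain c where e: "e \<subseteq> {..<q}" "card e = 2" "\<And>i. i \<in> e \<Longrightarrow> f i = c"
        by (auto simp: mono_pairs_def)
      then have "f' i = Suc c" if "i \<in> e" for i using that by (auto simp: f'_def)
      then show ?thesis using e(1,2) by (auto simp: mono_pairs_def)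
    next
      assume e: "e \<in> {e. e \<subseteq> {q..<q + s} \<and> card e = 2}"
      then have "f' i = 0" if "i \<in> e" for i using that by (auto simp: f'_def)
      then show ?thesis using e by (auto simp: mono_pairs_def)
    qed
  qed
  moreover have "mono_pairs f q \<inter> {e. e \<subseteq> {q..<q + s} \<and> card e = 2} = {}"
  proof -
    have False if "e \<subseteq> {..<q}" "e \<subseteq> {q..<q + s}" "card e = 2" for e
    proof -
      have "e = {}" using that(1,2) by fastforce
      then show False using that(3) by simp
    qed
    then show ?thesis by (auto simp: mono_pairs_def)
  qed
  moreover have "finite (mono_pairs f q)"
    by (rule finite_subset[of _ "Pow {..<q}"]) (auto simp: mono_pairs_def)
  moreover have "card {e. e \<subseteq> {q..<q + s} \<and> card e = 2} = s choose 2"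
    using n_subsets[of "{q..<q + s}" 2] by simp
  moreover have "finite {e. e \<subseteq> {q..<q + s} \<and> card e = 2}"
    by (rule finite_subset[of _ "Pow {q..<q + s}"]) auto
  ultimately have "card (mono_pairs f' (q + s)) = card (mono_pairs f q) + (s choose 2)"
    by (simp add: card_Un_disjoint)
  then show ?thesis by blast
qed

text \<open>Colour classes of sizes \<open>3\<close>, \<open>2\<close> and \<open>1\<close> contribute \<open>3\<close>, \<open>1\<close> and \<open>0\<close> pairs.\<close>

lemma mono_pairs_exists: "t + 2 \<le> q \<Longrightarrow> \<exists>f. card (mono_pairs f q) = t"
proof (induction t arbitrary: q rule: less_induct)
  case (less t)
  \<comment> \<open>Singleton classes contribute no pair and use up the remaining vertices.\<close>
  have grow: "\<exists>f. card (mono_pairs f (q + j)) = t" if "\<exists>f. card (mono_pairs f q) = t" for q j t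
  proof (induction j)
    case (Suc j)
    then obtain f where "card (mono_pairs f (q + j)) = t" by blast
    then show ?case using mono_pairs_add_class[of "q + j" 1 f] by (simp add: numeral_2_eq_2)
  qed (use that in simp)
  have zero: "\<exists>f. card (mono_pairs f 0) = 0"
  proof -
    have "mono_pairs id 0 = {}" by (auto simp: mono_pairs_def)
    then show ?thesis by (metis card.empty)
  qed
  have pair: "\<exists>f. card (mono_pairs f (q + 2)) = Suc t" if "\<exists>f. card (mono_pairs f q) = t" for q t
    using that mono_pairs_add_class[of q 2] by (auto simp: numeral_2_eq_2)
  consider "t = 0" | "t = 1" | "t = 2" | "t \<ge> 3" by linarith
  then show ?case
  proof cases
    case 1
    then show ?thesis using grow[OF zero, of q] by simp
  next
    case 2
    then have "0 + 2 + (q - 2) = q" using less.prems by simp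
    then show ?thesis using grow[OF pair[OF zero], of "q - 2"] 2 by simp
  next
    case 3
    \<comment> \<open>Two classes of size \<open>2\<close> need \<open>4 = t + 2\<close> vertices;
      here the hypothesis on \<open>q\<close> is sharp.\<close>
    then have "0 + 2 + 2 + (q - 4) = q" using less.prems by simp
    then show ?thesis using grow[OF pair[OF pair[OF zero]], of "q - 4"] 3 by (simp add: numeral_2_eq_2)
  next
    case 4
    \<comment> \<open>A class of size \<open>3\<close> lowers both \<open>t\<close> and
      \<open>q\<close> by \<open>3\<close>, which preserves the hypothesis.\<close>
    then have "t - 3 < t" "t - 3 + 2 \<le> q - 3" using less.prems by linarith+
    then obtain f where f: "card (mono_pairs f (q - 3)) = t - 3" using less.IH by blast
    have "q - 3 + 3 = q" "t - 3 + (3 choose 2) = t" using 4 less.prems by (simp_all add: choose_two)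
    then show ?thesis using mono_pairs_add_class[of "q - 3" 3 f] f by simp
  qed
qed

text \<open>The vertices \<open>1, ..., q\<close> form one block, to which \<open>Suc\<close>
  carries \<open>{..<q}\<close>, and all larger ones have labels of their own. Edges and
  monochromatic pairs together make up all pairs of the block; the sum avoids truncated
  subtraction.\<close>

lemma card_multipartite_edges:
  assumes "q < n"
  shows "card (block_edges n (\<lambda>w. if w \<le> q then 0 else w) (\<lambda>w. f (w - 1))) + card (mono_pairs f q) = q choose 2"
proof -
  let ?H = "block_edges n (\<lambda>w. if w \<le> q then 0 else w) (\<lambda>w. f (w - 1))"
  define P where "P = {e. e \<subseteq> {..<q} \<and> card e = 2}"
  have P: "finite P" "card P = q choose 2"
    using n_subsets[of "{..<q}" 2] finite_subset[of P "Pow {..<q}"] by (auto simp: P_def)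
  have M: "mono_pairs f q \<subseteq> P" by (auto simp: mono_pairs_def P_def)
  have "?H = (`) Suc ` (P - mono_pairs f q)"
  proof (intro equalityI subsetI)
    fix e assume "e \<in> ?H"
    then obtain u v where uv: "e = {u, v}" "u \<in> {1..<n}" "v \<in> {1..<n}" "f (u - 1) \<noteq> f (v - 1)"
      "(if u \<le> q then 0 else u) = (if v \<le> q then 0 else v)"
      by (auto simp: block_edges_def)
    then have "u \<noteq> v" by auto
    then have le: "u \<le> q" "v \<le> q" using uv(2,3,5) by (auto split: if_splits)
    have "{u - 1, v - 1} \<in> P - mono_pairs f q"
      using uv(2-4) le \<open>u \<noteq> v\<close> by (auto simp: P_def mono_pairs_def card_insert_if)
    moreover have "e = Suc ` {u - 1, v - 1}" using uv(1-3) by auto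
    ultimately show "e \<in> (`) Suc ` (P - mono_pairs f q)" by blast
  next
    fix e assume "e \<in> (`) Suc ` (P - mono_pairs f q)"
    then obtain e' where e': "e = Suc ` e'" "e' \<in> P" "e' \<notin> mono_pairs f q" by blast
    then obtain i j where ij: "e' = {i, j}" "i \<noteq> j" by (auto simp: P_def card_2_iff)
    have "i < q" "j < q" "f i \<noteq> f j" using e'(2,3) ij by (auto simp: P_def mono_pairs_def)
    then show "e \<in> ?H" using e'(1) ij assms unfolding block_edges_def
      by (intro CollectI exI[of _ "Suc i"] exI[of _ "Suc j"]) auto
  qed
  moreover have "inj_on ((`) Suc) (P - mono_pairs f q)" by (simp add: inj_on_def inj_image_eq_iff)
  ultimately have "card ?H = card (P - mono_pairs f q)" by (simp add: card_image)
  also have "\<dots> = card P - card (mono_pairs f q)"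
    using M P finite_subset by (intro card_Diff_subset) auto
  finally show ?thesis using card_mono[OF P(1) M] P(2) by simp
qed

text \<open>With \<open>q\<close> least such that \<open>k \<le> q choose 2\<close>, fewer than \<open>q - 1\<close> pairs must be left out of the
  complete graph on \<open>q\<close> vertices.\<close>

lemma multipartite_cone_exists:
  assumes "n \<ge> 2" "k \<ge> 1" "k \<le> (n - 1) choose 2"
  shows "\<exists>G\<in>graphs n (n - 1 + k). graph_delta G \<le> 1"
proof -
  define q where "q = (LEAST q. k \<le> q choose 2)"
  have q: "k \<le> q choose 2" "q \<le> n - 1"
    unfolding q_def using assms(3) by (rule LeastI, rule Least_le)
  have "q \<noteq> 0" using q(1) assms(2) by (intro notI) (simp add: numeral_2_eq_2)
  then obtain p where p: "q = Suc p" using not0_implies_Suc by blast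
  have "p choose 2 < k" using not_less_Least[of p "\<lambda>q. k \<le> q choose 2"] p q_def by simp
  moreover have "q choose 2 = p + (p choose 2)" by (simp add: p numeral_2_eq_2)
  ultimately have "(q choose 2) - k + 2 \<le> q" using p q(1) by linarith
  then obtain f where f: "card (mono_pairs f q) = (q choose 2) - k" using mono_pairs_exists by blast
  let ?H = "block_edges n (\<lambda>w. if w \<le> q then 0 else w) (\<lambda>w. f (w - 1))"
  have "q < n" using q(2) assms(1) by linarith
  then have "card ?H + ((q choose 2) - k) = q choose 2" using card_multipartite_edges[of q n f] f by metis
  then have "card ?H = k" using q(1) by linarith
  then have "cone n ?H \<in> graphs n (n - 1 + k)" using cone_block_in_graphs[of n] assms(1) by (metis One_nat_def Suc_leD numeral_2_eq_2)
  then show ?thesis using graph_delta_multipartite_cone[OF assms(1)] by blast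
qed

section \<open>The three values of the minimum\<close>

lemma min_delta_eqI:
  assumes "\<exists>G\<in>graphs n m. graph_delta G \<le> r" "\<And>G. G \<in> graphs n m \<Longrightarrow> r \<le> graph_delta G"
  shows "min_delta n m = r"
proof -
  obtain G where "G \<in> graphs n m" "graph_delta G = r" using assms by (meson order_antisym)
  then show ?thesis unfolding min_delta_def using assms(2) by (intro Least_equality) auto
qed

theorem theorem5p11:
  fixes n m :: nat
  assumes "n \<ge> 1"
    and "n - 1 \<le> m"
    and "m \<le> n choose 2"
  shows "(m = n - 1 \<longrightarrow> min_delta n m = 0) \<and>
         (m \<ge> n \<and> 2 * m \<le> 3 * n - 3 \<longrightarrow> min_delta n m = 3 / 4) \<and>
         (m \<ge> n \<and> 2 * m > 3 * n - 3 \<longrightarrow> min_delta n m = 1)"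
proof (intro conjI impI)
  have card: "card (fst G) = n" "card (snd G) = m" if "G \<in> graphs n m" for G
    using that by (auto simp: graphs_def)
  show "min_delta n m = 0" if "m = n - 1"
  proof (rule min_delta_eqI)
    show "\<exists>G\<in>graphs n m. graph_delta G \<le> 0"
      using path_graph_in_graphs graph_delta_path_graph assms(1) that by blast
    show "0 \<le> graph_delta G" if "G \<in> graphs n m" for G
      using metric_graph.graph_delta_nonneg[OF metric_graph_of_graphs[OF that]] .
  qed
  \<comment> \<open>The apex of a cone accounts for \<open>n - 1\<close> edges, so \<open>k\<close>
    edges remain for the graph below it.\<close>
  define k where "k = m - (n - 1)"
  have k: "m = n - 1 + k" using assms(2) by (simp add: k_def)
  obtain n' where n': "n = Suc n'" using assms(1) by (cases n) auto
  \<comment> \<open>Turns the bound on \<open>m\<close> into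
    \<open>k \<le> (n - 1) choose 2\<close>.\<close>
  have n_choose: "n choose 2 = (n - 1) + ((n - 1) choose 2)" by (simp add: n' numeral_2_eq_2)
  have n: "n \<ge> 2" if "m \<ge> n"
  proof (rule ccontr)
    assume "\<not> 2 \<le> n"
    then have "n = 1" using assms(1) by simp
    then show False using that assms(3) by (simp add: numeral_2_eq_2)
  qed
  show "min_delta n m = 3 / 4" if *: "m \<ge> n \<and> 2 * m \<le> 3 * n - 3"
  proof (rule min_delta_eqI)
    have "2 * k \<le> n - 1" using * k by linarith
    then show "\<exists>G\<in>graphs n m. graph_delta G \<le> 3 / 4"
      using friendship_graph_exists[of n k] n * unfolding k by blast
    show "3 / 4 \<le> graph_delta G" if "G \<in> graphs n m" for G
      using metric_graph.graph_delta_ge_3_4[OF metric_graph_of_graphs[OF that]] card[OF that] * by simp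
  qed
  show "min_delta n m = 1" if *: "m \<ge> n \<and> 2 * m > 3 * n - 3"
  proof (rule min_delta_eqI)
    have "1 \<le> k" "k \<le> (n - 1) choose 2" using * k n_choose assms(1,3) by linarith+
    then show "\<exists>G\<in>graphs n m. graph_delta G \<le> 1"
      using multipartite_cone_exists[of n k] n * unfolding k by blast
    show "1 \<le> graph_delta G" if "G \<in> graphs n m" for G
      using metric_graph.graph_delta_ge_1[OF metric_graph_of_graphs[OF that]] card[OF that] * by simp
  qed
qed

end
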